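(* Let $\mathcal{L}\subset\mathbb{R}^d$ be a $d$-dimensional lattice whose fundamental domain $\mathcal{D}$ satisfies $m_d(\mathcal{D})=1$, and let $\{\xi_n\}_{n\in\mathcal{L}}$ be independent and identically distributed random vectors in $\mathbb{R}^d$, all with common probability law $\xi$. Let $W$ be the random point process $$W:=\{n+\xi_n \mid n\in\mathcal{L}\},$$ and let $$M_R(\lambda):=\frac{1}{m_d(B_R)}\sum_{w\in W\cap B_R}\overline{e(\langle w,\lambda\rangle)} .$$ Assume that there exists some $\varepsilon>0$ such that $\mathbb{E}\left[|\xi|^{d+\varepsilon}\right]<\infty$. Then, almost surely, for all $\lambda\in\mathbb{R}^d$, we have $$\lim_{R\to\infty}M_R(\lambda)=\begin{cases}\varphi_\xi(\lambda) & \lambda\in\mathcal{L}^\ast,\\ 0 & \lambda\notin\mathcal{L}^\ast,\end{cases}$$ where $\varphi_\xi(\lambda):=\mathbb{E}\left[\overline{e(\langle\xi,\lambda\rangle)}\right]$ is the characteristic function of the random vector $\xi$.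
   Context: $m_d$ is Lebesgue measure on $\mathbb{R}^d$, $|\cdot|$ and $\langle\cdot,\cdot\rangle$ are the Euclidean norm and inner product, $B_R:=\{x\in\mathbb{R}^d : |x|\le R\}$, and $e(t):=\exp(2\pi i t)$. The dual lattice is $\mathcal{L}^\ast:=\{m\in\mathbb{R}^d : \langle n,m\rangle\in\mathbb{Z}\text{ for all } n\in\mathcal{L}\}$. "Almost surely, for all $\lambda$" means that there is a single probability-zero event, not depending on $\lambda$, outside of which the limit relation holds for all $\lambda\in\mathbb{R}^d$ at the same time. *)

theory Defs
  imports "HOL-Probability.Probability"
begin

definition full_lattice :: "(real ^ 'd) set \<Rightarrow> bool" where
  "full_lattice L \<longleftrightarrow>
     (\<exists>B. independent B \<and> span B = UNIV \<and>
          L = {\<Sum>b\<in>B. of_int (k b) *\<^sub>R b | k. k \<in> (UNIV :: (real ^ 'd \<Rightarrow> int) set)})"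

definition fundamental_domain :: "(real ^ 'd) set \<Rightarrow> (real ^ 'd) set \<Rightarrow> bool" where
  "fundamental_domain L D \<longleftrightarrow> D \<in> sets lebesgue \<and> (\<forall>x. \<exists>!n. n \<in> L \<and> x - n \<in> D)"

definition dual_lattice :: "(real ^ 'd) set \<Rightarrow> (real ^ 'd) set" where
  "dual_lattice L = {m. \<forall>n\<in>L. n \<bullet> m \<in> \<int>}"

definition unit_exp :: "real \<Rightarrow> complex" where
  "unit_exp t = exp (2 * of_real pi * \<i> * of_real t)"

definition char_fun :: "(real ^ 'd) measure \<Rightarrow> real ^ 'd \<Rightarrow> complex" where
  "char_fun \<mu> l = (LINT x|\<mu>. cnj (unit_exp (x \<bullet> l)))"

(* A point configuration is an indexed family p on I, so coinciding points are
   counted with multiplicity.  When infinitely many indices have their point in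
   the ball, the sum is 0 by the convention for sum; for a perturbed
   lattice with a finite moment of order d this happens only on a null event. *)
definition ball_average ::
    "'i set \<Rightarrow> ('i \<Rightarrow> real ^ 'd) \<Rightarrow> real \<Rightarrow> real ^ 'd \<Rightarrow> complex" where
  "ball_average I p R l =
     (\<Sum>i\<in>{i \<in> I. p i \<in> cball 0 R}. cnj (unit_exp (p i \<bullet> l))) / of_real (measure lebesgue (cball (0 :: real ^ 'd) R))"

definition perturbed_lattice :: "(real ^ 'd \<Rightarrow> 'w \<Rightarrow> real ^ 'd) \<Rightarrow> 'w \<Rightarrow> real ^ 'd \<Rightarrow> real ^ 'd" where
  "perturbed_lattice \<xi> \<omega> n = n + \<xi> n \<omega>"

end

theory Submission imports Defs "HOL-Real_Asymp.Real_Asymp" begin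

text \<open>
  Since \<open>|\<xi>|\<close> has a finite moment of order \<open>d\<close>, almost surely \<open>|\<xi>\<^sub>n| \<le> \<delta> |n|\<close> for all but finitely many \<open>n\<close>, for
  every \<open>\<delta> > 0\<close>. Hence the points of \<open>W\<close> in \<open>B\<^sub>R\<close> may be replaced by those with \<open>|n| \<le> \<lfloor>R\<rfloor>\<close>: the two
  index sets differ inside a thin annulus, up to finitely many points. Replacing each summand by its
  mean \<open>e(-\<langle>n,\<lambda>\<rangle>) \<phi>(\<lambda>)\<close> leaves the exponential sum of the lattice, whose average tends to the
  indicator of the dual lattice because translating by \<open>h \<in> L\<close> multiplies it by a fixed phase.
  The deviation from the mean is controlled for all \<open>\<lambda>\<close> simultaneously: Hoeffding's inequality beats
  the polynomial cardinality of a grid of mesh \<open>1/N\<^sup>2\<close> in the cube \<open>[-N, N]\<^sup>d\<close>, and for \<open>|n| \<le> N\<close>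
  the summands are Lipschitz in \<open>\<lambda>\<close> with constant \<open>O(N)\<close>.
\<close>

subsection \<open>Counting points of a lattice\<close>

lemma full_latticeE:
  fixes L :: "(real ^ 'd) set"
  assumes "full_lattice L"
  obtains B where "independent B" "span B = UNIV" "finite B"
    "L = range (\<lambda>k. \<Sum>b\<in>B. of_int (k b) *\<^sub>R b)"
  using assms independent_imp_finite unfolding full_lattice_def full_SetCompr_eq by blast

lemma full_lattice_zero: "full_lattice L \<Longrightarrow> 0 \<in> L"
  by (erule full_latticeE) (auto intro!: range_eqI[where x = "\<lambda>_. 0"])

lemma full_lattice_diff:
  assumes "full_lattice L" "x \<in> L" "y \<in> L"
  shows "x - y \<in> L"
proof -
  obtain B where L: "L = range (\<lambda>k. \<Sum>b\<in>B. of_int (k b) *\<^sub>R b)"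
    using assms(1) by (rule full_latticeE)
  obtain k j where "x = (\<Sum>b\<in>B. of_int (k b) *\<^sub>R b)" "y = (\<Sum>b\<in>B. of_int (j b) *\<^sub>R b)"
    using assms(2,3) unfolding L by blast
  hence "x - y = (\<Sum>b\<in>B. of_int (k b - j b) *\<^sub>R b)"
    by (simp add: sum_subtractf scaleR_diff_left)
  thus ?thesis
    unfolding L by (intro range_eqI[where x = "\<lambda>b. k b - j b"])
qed

lemma full_lattice_countable:
  assumes "full_lattice L"
  shows "countable L"
proof -
  obtain B where B: "finite B" and L: "L = range (\<lambda>k. \<Sum>b\<in>B. of_int (k b) *\<^sub>R b)"
    using assms by (rule full_latticeE)
  \<comment> \<open>Coefficients outside \<open>B\<close> do not affect the sum. Functions on the
    finite set \<open>B\<close> therefore suffice, and there are only countably many of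
    them.\<close>
  have "L \<subseteq> (\<lambda>k. \<Sum>b\<in>B. of_int (k b) *\<^sub>R b) ` (PiE B (\<lambda>_. UNIV :: int set))"
  proof
    fix x assume "x \<in> L"
    then obtain k where "x = (\<Sum>b\<in>B. of_int (k b) *\<^sub>R b)"
      unfolding L by blast
    thus "x \<in> (\<lambda>k. \<Sum>b\<in>B. of_int (k b) *\<^sub>R b) ` (PiE B (\<lambda>_. UNIV :: int set))"
      by (intro image_eqI[where x = "restrict k B"]) auto
  qed
  thus ?thesis
    by (rule countable_subset) (intro countable_image countable_PiE B, simp)
qed

text \<open>The half-open parallelepiped of a lattice basis works: the lattice part of a vector is
  obtained by taking integer parts of its coordinates. Boundedness is the point, since a general
  fundamental domain may be unbounded and the counting below compares balls with translates of
  \<open>P\<close>.\<close>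

lemma full_lattice_bounded_fundamental_domain:
  fixes L :: "(real ^ 'd) set"
  assumes "full_lattice L"
  obtains P where "fundamental_domain L P" "bounded P"
proof -
  obtain B where B: "independent B" "span B = UNIV" "finite B"
    and L: "L = range (\<lambda>k. \<Sum>b\<in>B. of_int (k b) *\<^sub>R b)"
    using assms by (rule full_latticeE)
  define c where "c = representation B"
  have c_lin: "linear (\<lambda>x. c x b)" for b
    using real_vector.linear_representation[OF B(1,2)]
    by (simp add: c_def linear_def real_scaleR_def[abs_def])
  have c_sum: "(\<Sum>b\<in>B. c x b *\<^sub>R b) = x" for x
    unfolding c_def using B by (intro real_vector.sum_representation_eq) auto
  have c_eqI: "c (\<Sum>b\<in>B. f b *\<^sub>R b) b = f b" if "b \<in> B" for f b
  proof -
    have "c (\<Sum>b\<in>B. f b *\<^sub>R b) b = (\<Sum>a\<in>B. f a * c a b)"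
      by (simp add: linear_sum[OF c_lin] linear_cmul[OF c_lin])
    also have "\<dots> = (\<Sum>a\<in>B. if a = b then f a else 0)"
      by (intro sum.cong) (auto simp: c_def real_vector.representation_basis[OF B(1)])
    finally show ?thesis
      using that B(3) by simp
  qed
  define P where "P = {x. \<forall>b\<in>B. c x b \<in> {0..<1}}"
  have "P = (\<Inter>b\<in>B. {x \<in> space borel. 0 \<le> c x b \<and> c x b < 1})"
    by (auto simp: P_def)
  also have "\<dots> \<in> sets borel"
  proof (cases "B = {}")
    case False
    have [measurable]: "(\<lambda>x. c x b) \<in> borel_measurable borel" for b
      by (intro borel_measurable_continuous_onI linear_continuous_on c_lin
            linear_conv_bounded_linear[THEN iffD1])
    thus ?thesis
      by (intro sets.finite_INT B(3) False) measurable
  qed simp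
  finally have "P \<in> sets lebesgue"
    by simp
  moreover have "\<exists>!n. n \<in> L \<and> x - n \<in> P" for x
  proof (rule ex1I)
    let ?n = "\<Sum>b\<in>B. of_int \<lfloor>c x b\<rfloor> *\<^sub>R b"
    show "?n \<in> L \<and> x - ?n \<in> P"
      unfolding L P_def using floor_correct[of "c x _"]
      by (auto simp: linear_diff[OF c_lin] c_eqI intro!: range_eqI[where x = "\<lambda>b. \<lfloor>c x b\<rfloor>"])
        linarith
  next
    fix n assume n: "n \<in> L \<and> x - n \<in> P"
    then obtain k where k: "n = (\<Sum>b\<in>B. of_int (k b) *\<^sub>R b)"
      unfolding L by blast
    have "\<lfloor>c x b\<rfloor> = k b" if "b \<in> B" for b
    proof -
      have "c (x - n) b = c x b - of_int (k b)"
        using that by (simp add: linear_diff[OF c_lin] c_eqI k)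
      thus ?thesis
        using n that unfolding P_def by (intro floor_unique) auto
    qed
    thus "n = (\<Sum>b\<in>B. of_int \<lfloor>c x b\<rfloor> *\<^sub>R b)"
      by (simp add: k)
  qed
  moreover have "bounded P"
    unfolding bounded_iff
  proof (intro exI ballI)
    fix x assume x: "x \<in> P"
    have "norm x = norm (\<Sum>b\<in>B. c x b *\<^sub>R b)"
      by (simp add: c_sum)
    also have "\<dots> \<le> (\<Sum>b\<in>B. norm b)"
      using x by (intro sum_norm_le) (auto simp: P_def mult_left_le_one_le abs_if)
    finally show "norm x \<le> (\<Sum>b\<in>B. norm b)" .
  qed
  ultimately show ?thesis
    by (intro that[of P]) (auto simp: fundamental_domain_def)
qed

section \<open>Equal measure of fundamental domains, and the density of a lattice\<close>

lemma emeasure_lebesgue_translation: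
  fixes a :: "'a :: euclidean_space"
  shows "emeasure lebesgue ((+) a ` S) = emeasure lebesgue S"
  using emeasure_lebesgue_affine[of 1 a S] by (simp add: ac_simps cong: image_cong_simp)

lemma mem_translation: "x \<in> (+) a ` S \<longleftrightarrow> x - a \<in> S" for a :: "'a :: ab_group_add"
  by (metis add_diff_cancel_left' diff_add_cancel add.commute image_iff)

lemma fundamental_domain_disjoint:
  assumes "fundamental_domain L D"
  shows "disjoint_family_on (\<lambda>n. S \<inter> (+) n ` D) L"
  unfolding disjoint_family_on_def
proof (intro ballI impI equals0I)
  fix m n x assume *: "m \<in> L" "n \<in> L" "m \<noteq> n" "x \<in> (S \<inter> (+) m ` D) \<inter> (S \<inter> (+) n ` D)"
  hence "x - m \<in> D" "x - n \<in> D"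
    by (simp_all only: Int_iff mem_translation)
  thus False
    using * assms unfolding fundamental_domain_def by blast
qed

text \<open>Cut \<open>D\<close> along the translates of \<open>P\<close> and move each piece
  \<open>D \<inter> (n + P)\<close> by \<open>- n\<close>; the results
  \<open>P \<inter> (D - n)\<close> are disjoint parts of \<open>P\<close>. Used in both directions,
  this transfers measure 1 from \<open>D\<close> to a bounded domain.\<close>

lemma fundamental_domain_emeasure_le:
  fixes L :: "(real ^ 'd) set"
  assumes L: "full_lattice L" and D: "fundamental_domain L D" and P: "fundamental_domain L P"
  shows "emeasure lebesgue D \<le> emeasure lebesgue P"
proof -
  note countable = full_lattice_countable[OF L]
  have [measurable]: "D \<in> sets lebesgue" "P \<in> sets lebesgue"
    using D P by (auto simp: fundamental_domain_def)
  have tr [measurable]: "(+) n ` S \<in> sets lebesgue" if "S \<in> sets lebesgue" for n :: "real ^ 'd" and S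
    using lebesgue_sets_translation[OF that, of n] .
  have neg: "- n \<in> L" if "n \<in> L" for n
    using full_lattice_diff[OF L full_lattice_zero[OF L] that] by simp
  have "D = (\<Union>n\<in>L. D \<inter> (+) n ` P)"
    using P unfolding fundamental_domain_def by (auto simp: mem_translation) blast
  also have "emeasure lebesgue \<dots> = (\<integral>\<^sup>+n. emeasure lebesgue (D \<inter> (+) n ` P) \<partial>count_space L)"
    by (intro emeasure_UN_countable fundamental_domain_disjoint P countable) auto
  also have "\<dots> = (\<integral>\<^sup>+n. emeasure lebesgue (P \<inter> (+) (- n) ` D) \<partial>count_space L)"
  proof (intro nn_integral_cong)
    fix n
    have "P \<inter> (+) (- n) ` D = (+) (- n) ` (D \<inter> (+) n ` P)"
      by (auto simp: mem_translation image_Int)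
    thus "emeasure lebesgue (D \<inter> (+) n ` P) = emeasure lebesgue (P \<inter> (+) (- n) ` D)"
      by (simp only: emeasure_lebesgue_translation)
  qed
  \<comment> \<open>Reindexing by the bijection \<open>uminus\<close> of \<open>L\<close>.\<close>
  also have "\<dots> = (\<integral>\<^sup>+n. emeasure lebesgue (P \<inter> (+) n ` D) \<partial>count_space L)"
    by (intro nn_integral_bij_count_space bij_betwI[where g = uminus]) (auto intro: neg)
  also have "\<dots> = emeasure lebesgue (\<Union>n\<in>L. P \<inter> (+) n ` D)"
    by (intro emeasure_UN_countable[symmetric] fundamental_domain_disjoint D countable) auto
  also have "\<dots> \<le> emeasure lebesgue P"
    by (intro emeasure_mono) auto
  finally show ?thesis .
qed

lemma measure_lebesgue_cball:
  "R \<ge> 0 \<Longrightarrow> measure lebesgue (cball (c :: 'a :: euclidean_space) R) =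
     unit_ball_vol (DIM('a)) * R ^ DIM('a)"
  by (simp add: content_cball measure_completion)

text \<open>The translates \<open>n + P\<close> of a bounded fundamental domain are disjoint and
  have measure 1, so the measure of their union over |n| \<le> R counts lattice points. If
  \<open>r\<close> bounds the norm on \<open>P\<close>, this union lies between the balls of radii R
  - r and R + r.\<close>

lemma full_lattice_count_bounds:
  fixes L :: "(real ^ 'd) set"
  assumes L: "full_lattice L" and D: "fundamental_domain L D" "emeasure lebesgue D = 1"
  shows "\<exists>r>0. \<forall>R. finite (L \<inter> cball 0 R) \<and>
    card (L \<inter> cball 0 R) \<le> measure lebesgue (cball (0 :: real ^ 'd) (R + r)) \<and>
    measure lebesgue (cball (0 :: real ^ 'd) (R - r)) \<le> card (L \<inter> cball 0 R)"
proof -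
  obtain P where P: "fundamental_domain L P" "bounded P"
    using L by (rule full_lattice_bounded_fundamental_domain)
  have mP: "emeasure lebesgue P = 1"
    using fundamental_domain_emeasure_le[OF L D(1) P(1)] fundamental_domain_emeasure_le[OF L P(1) D(1)] D(2)
    by simp
  obtain r where r: "r > 0" "\<And>x. x \<in> P \<Longrightarrow> norm x \<le> r"
    using P(2) by (auto simp: bounded_pos)
  have P_sets: "P \<in> sets lebesgue"
    using P by (auto simp: fundamental_domain_def)
  have tr: "(+) n ` P \<in> sets lebesgue" for n
    using lebesgue_sets_translation[OF P_sets, of n] .
  \<comment> \<open>Counting measure replaces \<open>card\<close> because finiteness of the lattice
    points in a ball is itself deduced from the volume bound \<open>up\<close>.\<close>
  have em: "emeasure lebesgue (\<Union>n\<in>F. (+) n ` P) = emeasure (count_space L) F" if "F \<subseteq> L" for F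
  proof -
    have "emeasure lebesgue (\<Union>n\<in>F. (+) n ` P) = (\<integral>\<^sup>+n. emeasure lebesgue ((+) n ` P) \<partial>count_space F)"
      using fundamental_domain_disjoint[OF P(1), of UNIV] that
      by (intro emeasure_UN_countable tr countable_subset[OF that full_lattice_countable[OF L]])
         (auto intro: disjoint_family_on_mono)
    also have "\<dots> = emeasure (count_space F) F"
      by (simp add: emeasure_lebesgue_translation mP)
    also have "\<dots> = emeasure (count_space L) F"
      using that by (auto simp: emeasure_count_space)
    finally show ?thesis .
  qed
  have fin_ball: "emeasure lebesgue (cball (0 :: real ^ 'd) R) < \<infinity>" for R
    using emeasure_lborel_cball_finite[of "0 :: real ^ 'd" R] by simp
  have "(\<Union>n\<in>L \<inter> cball 0 R. (+) n ` P) \<subseteq> cball (0 :: real ^ 'd) (R + r)" for R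
  proof safe
    fix n x :: "real ^ 'd" assume "n \<in> cball 0 R" "x \<in> P"
    thus "n + x \<in> cball 0 (R + r)"
      using norm_triangle_ineq[of n x] r(2)[of x] by simp
  qed
  hence up: "emeasure (count_space L) (L \<inter> cball 0 R) \<le> emeasure lebesgue (cball (0 :: real ^ 'd) (R + r))" for R
    by (subst em[symmetric]) (auto simp del: emeasure_completion intro!: emeasure_mono)
  have fin: "finite (L \<inter> cball 0 R)" for R
    using order.strict_trans1[OF up[of R] fin_ball] by (rule contrapos_pp) simp
  have card: "emeasure (count_space L) (L \<inter> cball 0 R) = ennreal (card (L \<inter> cball 0 R))" for R
    using fin[of R] by (simp add: emeasure_count_space_finite ennreal_of_nat_eq_real_of_nat)
  have ball: "emeasure lebesgue (cball (0 :: real ^ 'd) R) = ennreal (measure lebesgue (cball (0 :: real ^ 'd) R))" for R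
    using fin_ball[of R] by (intro emeasure_eq_ennreal_measure) auto
  have "cball 0 (R - r) \<subseteq> (\<Union>n\<in>L \<inter> cball 0 R. (+) n ` P)" for R
  proof
    fix x :: "real ^ 'd" assume x: "x \<in> cball 0 (R - r)"
    obtain n where n: "n \<in> L" "x - n \<in> P"
      using P(1) unfolding fundamental_domain_def by blast
    have "norm n \<le> R"
      using norm_triangle_ineq4[of x "x - n"] r(2)[OF n(2)] x by simp
    thus "x \<in> (\<Union>n\<in>L \<inter> cball 0 R. (+) n ` P)"
      using n by (auto simp: mem_translation)
  qed
  hence low: "emeasure lebesgue (cball (0 :: real ^ 'd) (R - r)) \<le> emeasure (count_space L) (L \<inter> cball 0 R)" for R
    by (subst em[symmetric]) (auto simp del: emeasure_completion intro!: emeasure_mono tr sets.countable_UN'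
        countable_subset[OF _ full_lattice_countable[OF L]])
  show ?thesis
    using up low fin r(1) unfolding card ball by (intro exI[of _ r]) simp
qed

lemma full_lattice_density:
  fixes L :: "(real ^ 'd) set"
  assumes L: "full_lattice L" and D: "fundamental_domain L D" "emeasure lebesgue D = 1"
  shows "finite (L \<inter> cball 0 R)"
    and "((\<lambda>R. card (L \<inter> cball 0 R) / measure lebesgue (cball (0 :: real ^ 'd) R)) \<longlongrightarrow> 1) at_top"
proof -
  obtain r where r: "r > 0" "\<And>R. finite (L \<inter> cball 0 R)"
    "\<And>R. card (L \<inter> cball 0 R) \<le> measure lebesgue (cball (0 :: real ^ 'd) (R + r))"
    "\<And>R. measure lebesgue (cball (0 :: real ^ 'd) (R - r)) \<le> card (L \<inter> cball 0 R)"
    using full_lattice_count_bounds[OF L D] by blast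
  show "finite (L \<inter> cball 0 R)"
    by (rule r)
  \<comment> \<open>The condition R > \<bar>s\<bar> keeps both radii positive, as the volume formula
    and the division require.\<close>
  have quot: "measure lebesgue (cball (0 :: real ^ 'd) (R + s)) / measure lebesgue (cball (0 :: real ^ 'd) R)
      = ((R + s) / R) ^ CARD('d)" if "R > \<bar>s\<bar>" for R s
    using that by (subst (1 2) measure_lebesgue_cball) (auto simp: power_divide unit_ball_vol_pos[THEN less_imp_neq, symmetric])
  have lim: "((\<lambda>R :: real. ((R + s) / R) ^ CARD('d)) \<longlongrightarrow> 1) at_top" for s
  proof -
    have "((\<lambda>R :: real. (R + s) / R) \<longlongrightarrow> 1) at_top"
      by real_asymp
    from tendsto_power[OF this, of "CARD('d)"] show ?thesis
      by simp
  qed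
  show "((\<lambda>R. card (L \<inter> cball 0 R) / measure lebesgue (cball (0 :: real ^ 'd) R)) \<longlongrightarrow> 1) at_top"
  proof (rule tendsto_sandwich[OF _ _ lim[of "- r"] lim[of r]])
    show "\<forall>\<^sub>F R in at_top. ((R + - r) / R) ^ CARD('d) \<le> card (L \<inter> cball 0 R) / measure lebesgue (cball (0 :: real ^ 'd) R)"
      using eventually_gt_at_top[of r]
    proof eventually_elim
      case (elim R)
      thus ?case
        using r(1) r(4)[of R] by (subst quot[symmetric]) (auto intro: divide_right_mono)
    qed
    show "\<forall>\<^sub>F R in at_top. card (L \<inter> cball 0 R) / measure lebesgue (cball (0 :: real ^ 'd) R) \<le> ((R + r) / R) ^ CARD('d)"
      using eventually_gt_at_top[of r]
    proof eventually_elim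
      case (elim R)
      thus ?case
        using r(1) r(3)[of R] by (subst quot[symmetric]) (auto intro: divide_right_mono)
    qed
  qed
qed

subsection \<open>Exponential sums over subgroups of density one\<close>

lemma unit_exp_eq_cis: "unit_exp t = cis (2 * pi * t)"
  by (simp add: unit_exp_def cis_conv_exp mult_ac)

lemma norm_unit_exp [simp]: "norm (unit_exp t) = 1"
  by (simp add: unit_exp_eq_cis)

lemma unit_exp_add: "unit_exp (s + t) = unit_exp s * unit_exp t"
  by (simp add: unit_exp_eq_cis cis_mult ring_distribs)

lemma unit_exp_eq_1_iff: "unit_exp t = 1 \<longleftrightarrow> t \<in> \<int>"
proof -
  have "unit_exp t = 1 \<longleftrightarrow> (\<exists>n :: int. 2 * pi * t = of_int (2 * n) * pi)"
    by (simp add: unit_exp_def exp_eq_1)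
  also have "\<dots> \<longleftrightarrow> (\<exists>n :: int. t = of_int n)"
    by (intro ex_cong1) auto
  finally show ?thesis
    by (auto simp: Ints_def)
qed

text \<open>Factor out the unimodular \<open>unit_exp t\<close> and use |exp(ix) - 1| \<le>
  |x|.\<close>

lemma norm_unit_exp_diff_le: "norm (unit_exp s - unit_exp t) \<le> 2 * pi * \<bar>s - t\<bar>"
proof -
  have "unit_exp s - unit_exp t = unit_exp t * (unit_exp (s - t) - 1)"
    using unit_exp_add[of t "s - t"] by (simp add: algebra_simps)
  also have "norm \<dots> = norm (exp (\<i> * of_real (2 * pi * (s - t))) - 1)"
    by (simp add: norm_mult unit_exp_def mult_ac)
  also have "\<dots> \<le> \<bar>2 * pi * (s - t)\<bar>"
    using iexp_approx1[of "2 * pi * (s - t)" 0] by simp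
  finally show ?thesis
    by (simp add: abs_mult)
qed

text \<open>The interface between lattice geometry and the averaging argument; the final theorem
  verifies it from a basis and a fundamental domain of measure 1.\<close>

locale unit_density_lattice =
  fixes L :: "(real ^ 'd) set"
  assumes zero_mem: "0 \<in> L"
    and diff_mem: "x \<in> L \<Longrightarrow> y \<in> L \<Longrightarrow> x - y \<in> L"
    and finite_ball: "finite (L \<inter> cball 0 R)"
    and density: "((\<lambda>R. card (L \<inter> cball 0 R) / measure lebesgue (cball (0 :: real ^ 'd) R)) \<longlongrightarrow> 1) at_top"
begin

section \<open>Volumes of balls and thin annuli\<close>

definition vol :: "real \<Rightarrow> real" where
  "vol R = measure lebesgue (cball (0 :: real ^ 'd) R)"

text \<open>The shell around the sphere of radius \<open>R\<close> in which a lattice point may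
  cross the sphere when moved by a small multiple of \<open>R\<close>.\<close>

definition annulus :: "real \<Rightarrow> real \<Rightarrow> (real ^ 'd) set" where
  "annulus \<delta> R = {n \<in> L. (1 - \<delta>) * R < norm n \<and> norm n \<le> (1 + \<delta>) * R}"

lemma countable: "countable L"
proof -
  have "L \<subseteq> (\<Union>N. L \<inter> cball 0 (real N))"
  proof
    fix x assume "x \<in> L"
    moreover obtain N where "norm x \<le> real N"
      using real_arch_simple by blast
    ultimately show "x \<in> (\<Union>N. L \<inter> cball 0 (real N))"
      by (intro UN_I[of N]) simp_all
  qed
  thus ?thesis
    by (rule countable_subset) (intro countable_UN countableI_type countable_finite[OF finite_ball])
qed

lemma add_mem: "x \<in> L \<Longrightarrow> y \<in> L \<Longrightarrow> x + y \<in> L"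
  using diff_mem[of x "0 - y"] diff_mem[OF zero_mem, of y] by simp

lemma vol_eq: "R \<ge> 0 \<Longrightarrow> vol R = unit_ball_vol (CARD('d)) * R ^ CARD('d)"
  unfolding vol_def by (subst measure_lebesgue_cball) auto

lemma vol_pos: "R > 0 \<Longrightarrow> vol R > 0"
  by (simp add: vol_eq)

lemma vol_scale: "a \<ge> 0 \<Longrightarrow> R \<ge> 0 \<Longrightarrow> vol (a * R) = a ^ CARD('d) * vol R"
  by (simp add: vol_eq power_mult_distrib)

lemma filterlim_vol: "filterlim vol at_top at_top"
proof -
  have "filterlim (\<lambda>R. unit_ball_vol (CARD('d)) * R ^ CARD('d)) at_top (at_top :: real filter)"
    by (intro filterlim_tendsto_pos_mult_at_top[OF tendsto_const] filterlim_pow_at_top filterlim_ident)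
       (auto simp: unit_ball_vol_pos)
  moreover have "\<forall>\<^sub>F R in at_top. unit_ball_vol (CARD('d)) * R ^ CARD('d) = vol R"
    using eventually_ge_at_top[of 0] by eventually_elim (simp add: vol_eq)
  ultimately show ?thesis
    by (rule filterlim_mono_eventually[OF _ order.refl order.refl])
qed

lemma count_scaled_tendsto:
  assumes "a > 0"
  shows "((\<lambda>R. card (L \<inter> cball 0 (a * R)) / vol R) \<longlongrightarrow> a ^ CARD('d)) at_top"
proof -
  have "filterlim (\<lambda>R. a * R) at_top at_top"
    by (intro filterlim_tendsto_pos_mult_at_top[OF tendsto_const] filterlim_ident assms)
  from tendsto_mult[OF filterlim_compose[OF density this] tendsto_const[of "a ^ CARD('d)"]]
  have "((\<lambda>R. card (L \<inter> cball 0 (a * R)) / vol (a * R) * a ^ CARD('d)) \<longlongrightarrow> a ^ CARD('d)) at_top"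
    by (simp add: vol_def del: measure_completion)
  moreover have "\<forall>\<^sub>F R in at_top. card (L \<inter> cball 0 (a * R)) / vol (a * R) * a ^ CARD('d)
      = card (L \<inter> cball 0 (a * R)) / vol R"
    using eventually_gt_at_top[of 0] by eventually_elim (use assms in \<open>simp add: vol_scale\<close>)
  ultimately show ?thesis
    by (rule Lim_transform_eventually)
qed

lemma finite_annulus: "finite (annulus \<delta> R)"
  by (rule finite_subset[OF _ finite_ball[of "(1 + \<delta>) * R"]]) (auto simp: annulus_def)

text \<open>Relative to \<open>vol R\<close> the annulus has limiting density (1 + \<delta>)^d - (1
  - \<delta>)^d, which tends to 0 with \<delta>.\<close>

lemma small_annulus:
  assumes "\<eta> > 0"
  obtains \<delta> where "\<delta> > 0" "\<delta> < 1" "\<forall>\<^sub>F R in at_top. card (annulus \<delta> R) \<le> \<eta> * vol R"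
proof -
  have "((\<lambda>\<delta> :: real. (1 + \<delta>) ^ CARD('d) - (1 - \<delta>) ^ CARD('d)) \<longlongrightarrow> (1 + 0) ^ CARD('d) - (1 - 0) ^ CARD('d)) (at_right 0)"
    by (intro tendsto_intros)
  hence "\<forall>\<^sub>F \<delta> in at_right 0. (1 + \<delta>) ^ CARD('d) - (1 - \<delta>) ^ CARD('d) < \<eta>"
    using assms by (intro order_tendstoD(2)) auto
  moreover have "\<forall>\<^sub>F \<delta> :: real in at_right 0. \<delta> > 0 \<and> \<delta> < 1"
    using eventually_at_right_real[of 0 "1 :: real"] by (rule eventually_mono) auto
  ultimately have "\<exists>\<delta>. (1 + \<delta>) ^ CARD('d) - (1 - \<delta>) ^ CARD('d) < \<eta> \<and> \<delta> > 0 \<and> \<delta> < 1"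
    by (intro eventually_happens'[OF trivial_limit_at_right_real eventually_conj]) auto
  then obtain \<delta> where \<delta>: "(1 + \<delta>) ^ CARD('d) - (1 - \<delta>) ^ CARD('d) < \<eta>" "\<delta> > 0" "\<delta> < 1"
    by blast
  have card: "real (card (annulus \<delta> R)) = real (card (L \<inter> cball 0 ((1 + \<delta>) * R))) - real (card (L \<inter> cball 0 ((1 - \<delta>) * R)))"
    if "R \<ge> 0" for R
  proof -
    have le: "(1 - \<delta>) * R \<le> (1 + \<delta>) * R"
      using that \<delta> by (intro mult_right_mono) auto
    have "annulus \<delta> R = L \<inter> cball 0 ((1 + \<delta>) * R) - L \<inter> cball 0 ((1 - \<delta>) * R)"
      by (auto simp: annulus_def)
    moreover have "L \<inter> cball 0 ((1 - \<delta>) * R) \<subseteq> L \<inter> cball 0 ((1 + \<delta>) * R)"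
      using le by auto
    ultimately show ?thesis
      using finite_ball by (simp add: card_Diff_subset card_mono of_nat_diff)
  qed
  have "((\<lambda>R. card (L \<inter> cball 0 ((1 + \<delta>) * R)) / vol R - card (L \<inter> cball 0 ((1 - \<delta>) * R)) / vol R) \<longlongrightarrow>
      (1 + \<delta>) ^ CARD('d) - (1 - \<delta>) ^ CARD('d)) at_top"
    using \<delta> by (intro tendsto_diff count_scaled_tendsto) auto
  from order_tendstoD(2)[OF this \<delta>(1)] eventually_gt_at_top[of 0]
  have "\<forall>\<^sub>F R in at_top. card (annulus \<delta> R) \<le> \<eta> * vol R"
  proof eventually_elim
    case (elim R)
    thus ?case
      using vol_pos[of R] card[of R] by (simp add: pos_divide_less_eq flip: diff_divide_distrib)
  qed
  with \<delta> that show ?thesis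
    by blast
qed

text \<open>The common tool for exchanging index sets: a thin annulus costs at most \<eta>/2 of the
  volume, and a fixed finite set is negligible against \<open>vol R\<close>. The set
  \<open>F\<close> may depend on \<delta> but not on \<open>R\<close>. It serves both for
  translating the lattice and for passing from points of the process in a ball to lattice points in
  a ball.\<close>

lemma sum_diff_tendsto_0:
  fixes f :: "real \<Rightarrow> real ^ 'd \<Rightarrow> complex"
  assumes f: "\<And>R n. norm (f R n) \<le> 1"
    and fin: "\<And>R. finite (A R)" "\<And>R. finite (B R)"
    and diff: "\<And>\<delta>. 0 < \<delta> \<Longrightarrow> \<delta> < 1 \<Longrightarrow>
      \<exists>F. finite F \<and> (\<forall>\<^sub>F R in at_top. (A R - B R) \<union> (B R - A R) \<subseteq> F \<union> annulus \<delta> R)"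
  shows "((\<lambda>R. ((\<Sum>n\<in>A R. f R n) - (\<Sum>n\<in>B R. f R n)) / of_real (vol R)) \<longlongrightarrow> 0) at_top"
proof (rule tendstoI)
  fix \<eta> :: real assume "\<eta> > 0"
  then obtain \<delta> where \<delta>: "\<delta> > 0" "\<delta> < 1" "\<forall>\<^sub>F R in at_top. card (annulus \<delta> R) \<le> \<eta> / 2 * vol R"
    using small_annulus[of "\<eta> / 2"] by auto
  obtain F where F: "finite F" "\<forall>\<^sub>F R in at_top. (A R - B R) \<union> (B R - A R) \<subseteq> F \<union> annulus \<delta> R"
    using diff[OF \<delta>(1,2)] by blast
  \<comment> \<open>Rearranged, \<open>card F < \<eta> / 2 * vol R\<close>: the other half of the
    error budget.\<close>
  have "\<forall>\<^sub>F R in at_top. vol R > 2 / \<eta> * real (card F)"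
    using filterlim_vol by (simp add: filterlim_at_top_dense)
  thus "\<forall>\<^sub>F R in at_top. dist (((\<Sum>n\<in>A R. f R n) - (\<Sum>n\<in>B R. f R n)) / of_real (vol R)) 0 < \<eta>"
    using F(2) \<delta>(3) eventually_gt_at_top[of 0]
  proof eventually_elim
    case (elim R)
    let ?S = "(A R - B R) \<union> (B R - A R)"
    have "(\<Sum>n\<in>A R. f R n) - (\<Sum>n\<in>B R. f R n) = (\<Sum>n\<in>A R - B R. f R n) - (\<Sum>n\<in>B R - A R. f R n)"
      using fin by (simp add: sum_diff1 sum.Int_Diff[of "A R" _ "B R"] sum.Int_Diff[of "B R" _ "A R"] Int_commute)
    also have "norm \<dots> \<le> (\<Sum>n\<in>A R - B R. 1) + (\<Sum>n\<in>B R - A R. 1)"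
      using f by (intro norm_triangle_le_diff add_mono sum_norm_le)
    also have "\<dots> = real (card ?S)"
      using fin by (subst card_Un_disjoint) auto
    also have "\<dots> \<le> real (card (F \<union> annulus \<delta> R))"
      using elim(2) F(1) finite_annulus by (auto intro!: card_mono)
    also have "real (card (F \<union> annulus \<delta> R)) \<le> card F + card (annulus \<delta> R)"
      using card_Un_le[of F "annulus \<delta> R"] by linarith
    also have "\<dots> < \<eta> * vol R"
      using elim(1,3) \<open>\<eta> > 0\<close> by (simp add: field_simps)
    finally show ?case
      using vol_pos[OF elim(4)] by (simp add: norm_divide pos_divide_less_eq)
  qed
qed

text \<open>On the dual lattice all terms equal 1 and the density applies. Otherwise some
  \<open>h \<in> L\<close> has a phase different from 1. Translating the ball by \<open>h\<close>
  multiplies the sum by the conjugate phase but changes it only by a boundary term, so the average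
  times (phase - 1) tends to 0.\<close>

lemma exponential_sum_tendsto:
  "((\<lambda>R. (\<Sum>n\<in>L \<inter> cball 0 R. cnj (unit_exp (n \<bullet> l))) / of_real (vol R))
      \<longlongrightarrow> (if l \<in> dual_lattice L then 1 else 0)) at_top"
proof (cases "l \<in> dual_lattice L")
  case True
  hence "unit_exp (n \<bullet> l) = 1" if "n \<in> L" for n
    using that by (simp add: dual_lattice_def unit_exp_eq_1_iff)
  hence "(\<Sum>n\<in>L \<inter> cball 0 R. cnj (unit_exp (n \<bullet> l))) = of_nat (card (L \<inter> cball 0 R))" for R
    by simp
  moreover have "((\<lambda>R. complex_of_real (card (L \<inter> cball 0 R) / vol R)) \<longlongrightarrow> of_real 1) at_top"
    using density unfolding vol_def by (rule tendsto_of_real)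
  ultimately show ?thesis
    using True by simp
next
  case False
  then obtain h where h: "h \<in> L" "unit_exp (h \<bullet> l) \<noteq> 1"
    by (auto simp: dual_lattice_def unit_exp_eq_1_iff)
  let ?A = "\<lambda>R. L \<inter> cball 0 R" and ?f = "\<lambda>n. cnj (unit_exp (n \<bullet> l))"
  have "((\<lambda>R. ((\<Sum>n\<in>(+) h ` ?A R. ?f n) - (\<Sum>n\<in>?A R. ?f n)) / of_real (vol R)) \<longlongrightarrow> 0) at_top"
  proof (rule sum_diff_tendsto_0)
    fix \<delta> :: real assume \<delta>: "\<delta> > 0" "\<delta> < 1"
    \<comment> \<open>Once |h| < \<delta>R, translation by \<open>h\<close> crosses the sphere of
      radius \<open>R\<close> only inside the annulus, so the finite exceptional set is
      empty.\<close>
    have "\<forall>\<^sub>F R in at_top. ((+) h ` ?A R - ?A R) \<union> (?A R - (+) h ` ?A R) \<subseteq> {} \<union> annulus \<delta> R"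
      using eventually_gt_at_top[of "norm h / \<delta>"]
    proof eventually_elim
      case (elim R)
      hence R: "norm h < \<delta> * R"
        using \<delta> by (simp add: field_simps)
      have "R * \<delta> \<ge> 0"
        using order.trans[OF norm_ge_zero less_imp_le[OF R]] by (simp add: mult.commute)
      have 1: "h + n \<in> annulus \<delta> R" if "n \<in> L" "norm n \<le> R" "\<not> norm (h + n) \<le> R" for n
        using that norm_triangle_ineq[of h n] R add_mem[OF h(1) that(1)] \<open>R * \<delta> \<ge> 0\<close>
        by (auto simp: annulus_def algebra_simps)
      have 2: "n \<in> annulus \<delta> R" if "n \<in> L" "norm n \<le> R" "n \<notin> (+) h ` ?A R" for n
      proof -
        have "norm (n - h) > R"
          using that diff_mem[OF that(1) h(1)] by (auto simp: mem_translation)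
        thus ?thesis
          using that norm_triangle_ineq4[of n h] R \<open>R * \<delta> \<ge> 0\<close>
          by (auto simp: annulus_def algebra_simps)
      qed
      show ?case
      proof (intro subsetI)
        fix x assume "x \<in> ((+) h ` ?A R - ?A R) \<union> (?A R - (+) h ` ?A R)"
        then consider n where "x = h + n" "n \<in> L" "norm n \<le> R" "h + n \<notin> ?A R"
          | "x \<in> L" "norm x \<le> R" "x \<notin> (+) h ` ?A R"
          by auto
        thus "x \<in> {} \<union> annulus \<delta> R"
          using 1 2 add_mem[OF h(1)] by cases auto
      qed
    qed
    thus "\<exists>F. finite F \<and> (\<forall>\<^sub>F R in at_top. ((+) h ` ?A R - ?A R) \<union> (?A R - (+) h ` ?A R) \<subseteq> F \<union> annulus \<delta> R)"
      by blast
  qed (auto simp: finite_ball)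
  moreover have "(\<Sum>n\<in>(+) h ` ?A R. ?f n) = ?f h * (\<Sum>n\<in>?A R. ?f n)" for R
    by (subst sum.reindex) (auto simp: inner_add_left unit_exp_add sum_distrib_left)
  ultimately have "((\<lambda>R. (?f h - 1) * ((\<Sum>n\<in>?A R. ?f n) / of_real (vol R))) \<longlongrightarrow> 0) at_top"
    by (simp add: algebra_simps)
  moreover have "?f h - 1 \<noteq> 0"
    using h(2) by (metis complex_cnj_cancel_iff complex_cnj_one eq_iff_diff_eq_0)
  ultimately have "((\<lambda>R. (\<Sum>n\<in>?A R. ?f n) / of_real (vol R)) \<longlongrightarrow> 0) at_top"
    by (subst (asm) tendsto_mult_left_iff[of "?f h - 1" _ 0, unfolded mult_zero_right])
  thus ?thesis
    using False by simp
qed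

text \<open>Makes the asymptotic density uniform over all radii: beyond some \<open>R0\<close> the
  count is below \<open>2 * vol R\<close>, and smaller balls are covered by a constant through
  monotonicity.\<close>

lemma count_bound:
  obtains C :: real where "C \<ge> 0" "\<And>R. R \<ge> 0 \<Longrightarrow> card (L \<inter> cball 0 R) \<le> C * (1 + R ^ CARD('d))"
proof -
  have "\<forall>\<^sub>F R in at_top. card (L \<inter> cball 0 R) / vol R < 2"
    using density unfolding vol_def by (rule order_tendstoD(2)) simp
  then obtain R0 where R0: "\<And>R. R \<ge> R0 \<Longrightarrow> card (L \<inter> cball 0 R) / vol R < 2"
    by (auto simp: eventually_at_top_linorder)
  define v where "v = unit_ball_vol (CARD('d))"
  define c where "c = real (card (L \<inter> cball 0 (max R0 1)))"
  have [simp]: "v > 0" "c \<ge> 0"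
    by (auto simp: v_def c_def)
  hence [simp]: "v \<ge> 0"
    by linarith
  have "card (L \<inter> cball 0 R) \<le> (c + 2 * v) * (1 + R ^ CARD('d))" if "R \<ge> 0" for R
  proof (cases "R \<le> max R0 1")
    case True
    hence "card (L \<inter> cball 0 R) \<le> c"
      unfolding c_def of_nat_le_iff by (intro card_mono finite_ball) auto
    also have "c * 1 \<le> (c + 2 * v) * (1 + R ^ CARD('d))"
      using that by (intro mult_mono) auto
    finally show ?thesis by simp
  next
    case False
    hence "R \<ge> R0" "R > 0"
      by auto
    hence "card (L \<inter> cball 0 R) \<le> 2 * vol R"
      using R0[of R] vol_pos[of R] by (simp add: pos_divide_less_eq)
    also have "\<dots> = 2 * v * R ^ CARD('d)"
      using that by (simp add: vol_eq v_def)
    also have "\<dots> \<le> (c + 2 * v) * (1 + R ^ CARD('d))"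
      using that by (intro mult_mono) auto
    finally show ?thesis .
  qed
  thus ?thesis
    by (intro that[of "c + 2 * v"]) auto
qed

end

subsection \<open>Independent perturbations\<close>

text \<open>Real Hoeffding applies to real and imaginary parts, which lie in [-1, 1]. Since |z|
  \<le> |Re z| + |Im z|, a deviation of \<open>2 * \<delta> * card I\<close> forces one of
  \<open>\<delta> * card I\<close> in a part; this explains the factors 2 and 4.\<close>

lemma (in prob_space) complex_Hoeffding:
  fixes Y :: "'i \<Rightarrow> 'a \<Rightarrow> complex" and \<delta> :: real
  assumes fin: "finite I" and ne: "I \<noteq> {}" and indep: "indep_vars (\<lambda>_. borel) Y I"
    and bound: "\<And>i \<omega>. i \<in> I \<Longrightarrow> norm (Y i \<omega>) \<le> 1" and "\<delta> \<ge> 0"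
  shows "prob {\<omega> \<in> space M. norm ((\<Sum>i\<in>I. Y i \<omega>) - (\<Sum>i\<in>I. expectation (Y i))) \<ge> 2 * \<delta> * card I}
    \<le> 4 * exp (- (\<delta>\<^sup>2 * card I / 2))"
proof -
  have meas [measurable]: "Y i \<in> borel_measurable M" if "i \<in> I" for i
    using indep that unfolding indep_vars_def by auto
  have integrable: "integrable M (Y i)" if "i \<in> I" for i
    using bound that by (intro integrable_const_bound[of _ 1]) auto
  \<comment> \<open>Here \<open>f\<close> stands for \<open>Re\<close> and \<open>Im\<close>.
    Measurability of the event is recorded too, for the union bound at the end.\<close>
  have part: "{\<omega> \<in> space M. \<bar>(\<Sum>i\<in>I. f (Y i \<omega>)) - (\<Sum>i\<in>I. f (expectation (Y i)))\<bar> \<ge> \<delta> * card I} \<in> events \<and>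
      prob {\<omega> \<in> space M. \<bar>(\<Sum>i\<in>I. f (Y i \<omega>)) - (\<Sum>i\<in>I. f (expectation (Y i)))\<bar> \<ge> \<delta> * card I}
      \<le> 2 * exp (- (\<delta>\<^sup>2 * card I / 2))"
    if f: "bounded_linear f" "\<And>z. \<bar>f z\<bar> \<le> norm z" for f :: "complex \<Rightarrow> real"
  proof -
    have f_meas [measurable]: "f \<in> borel_measurable borel"
      by (intro borel_measurable_continuous_onI linear_continuous_on f)
    have f_exp: "expectation (\<lambda>\<omega>. f (Y i \<omega>)) = f (expectation (Y i))" if "i \<in> I" for i
      by (rule integral_bounded_linear[OF f(1) integrable[OF that]])
    interpret Hoeffding_ineq M I "\<lambda>i \<omega>. f (Y i \<omega>)" "\<lambda>_. -1" "\<lambda>_. 1"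
      "\<Sum>i\<in>I. f (expectation (Y i))"
    proof unfold_locales
      show "indep_vars (\<lambda>_. borel) (\<lambda>i \<omega>. f (Y i \<omega>)) I"
        by (rule indep_vars_compose2[OF indep f_meas])
      show "AE \<omega> in M. f (Y i \<omega>) \<in> {-1..1}" if "i \<in> I" for i
        using order.trans[OF f(2) bound[OF that]] by (auto simp: abs_le_iff)
    qed (auto simp: fin f_exp intro!: sum.cong eq_reflection)
    have "prob {\<omega> \<in> space M. \<bar>(\<Sum>i\<in>I. f (Y i \<omega>)) - (\<Sum>i\<in>I. f (expectation (Y i)))\<bar> \<ge> \<delta> * card I}
        \<le> 2 * exp (- 2 * (\<delta> * card I)\<^sup>2 / (\<Sum>i\<in>I. (1 - - 1)\<^sup>2))"
      using \<open>\<delta> \<ge> 0\<close> fin ne by (intro Hoeffding_ineq_abs_ge) (auto intro!: sum_pos)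
    \<comment> \<open>Each interval has length 2, so the denominator is
      \<open>4 * card I\<close>.\<close>
    also have "- 2 * (\<delta> * card I)\<^sup>2 / (\<Sum>i\<in>I. (1 - - 1)\<^sup>2) = - (\<delta>\<^sup>2 * card I / 2)"
      using fin ne by (simp add: power2_eq_square field_simps)
    finally have "prob {\<omega> \<in> space M. \<bar>(\<Sum>i\<in>I. f (Y i \<omega>)) - (\<Sum>i\<in>I. f (expectation (Y i)))\<bar> \<ge> \<delta> * card I}
      \<le> 2 * exp (- (\<delta>\<^sup>2 * card I / 2))" .
    moreover have [measurable]: "(\<lambda>\<omega>. \<Sum>i\<in>I. f (Y i \<omega>)) \<in> borel_measurable M"
      by (intro borel_measurable_sum measurable_compose[OF meas f_meas])
    ultimately show ?thesis
      by simp
  qed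
  let ?S = "\<lambda>\<omega>. (\<Sum>i\<in>I. Y i \<omega>) - (\<Sum>i\<in>I. expectation (Y i))"
  let ?A = "\<lambda>f. {\<omega> \<in> space M. \<bar>(\<Sum>i\<in>I. f (Y i \<omega>)) - (\<Sum>i\<in>I. f (expectation (Y i)))\<bar> \<ge> \<delta> * card I}"
  have Re: "?A Re \<in> events \<and> prob (?A Re) \<le> 2 * exp (- (\<delta>\<^sup>2 * card I / 2))"
    by (intro part bounded_linear_Re abs_Re_le_cmod)
  have Im: "?A Im \<in> events \<and> prob (?A Im) \<le> 2 * exp (- (\<delta>\<^sup>2 * card I / 2))"
    by (intro part bounded_linear_Im abs_Im_le_cmod)
  have "{\<omega> \<in> space M. norm (?S \<omega>) \<ge> 2 * \<delta> * card I} \<subseteq> ?A Re \<union> ?A Im"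
  proof
    fix \<omega> assume \<omega>: "\<omega> \<in> {\<omega> \<in> space M. norm (?S \<omega>) \<ge> 2 * \<delta> * card I}"
    have "2 * \<delta> * card I \<le> \<bar>Re (?S \<omega>)\<bar> + \<bar>Im (?S \<omega>)\<bar>"
      using \<omega> cmod_le[of "?S \<omega>"] by simp
    hence "\<bar>Re (?S \<omega>)\<bar> \<ge> \<delta> * card I \<or> \<bar>Im (?S \<omega>)\<bar> \<ge> \<delta> * card I"
      by linarith
    thus "\<omega> \<in> ?A Re \<union> ?A Im"
      using \<omega> by simp
  qed
  hence "prob {\<omega> \<in> space M. norm (?S \<omega>) \<ge> 2 * \<delta> * card I} \<le> prob (?A Re \<union> ?A Im)"
    using Re Im by (intro finite_measure_mono) auto
  also have "\<dots> \<le> prob (?A Re) + prob (?A Im)"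
    using Re Im by (intro measure_Un_le) auto
  also have "\<dots> \<le> 4 * exp (- (\<delta>\<^sup>2 * card I / 2))"
    using Re Im by simp
  finally show ?thesis .
qed

section \<open>Frequency grids and Lipschitz dependence on the frequency\<close>

definition grid :: "nat \<Rightarrow> (real ^ 'd) set" where
  "grid N = (\<lambda>z. \<chi> i. of_int (z i) / real N ^ 2) ` (UNIV \<rightarrow>\<^sub>E {- (int N ^ 3)..int N ^ 3})"

lemma finite_grid: "finite (grid N)"
  unfolding grid_def by (intro finite_imageI finite_PiE) auto

lemma card_grid_le: "card (grid N :: (real ^ 'd) set) \<le> (2 * N ^ 3 + 1) ^ CARD('d)"
proof -
  have "card (grid N :: (real ^ 'd) set) \<le> card ((UNIV :: 'd set) \<rightarrow>\<^sub>E {- (int N ^ 3)..int N ^ 3})"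
    unfolding grid_def by (intro card_image_le finite_PiE) auto
  also have "\<dots> = (2 * N ^ 3 + 1) ^ CARD('d)"
    by (simp add: card_PiE nat_add_distrib nat_mult_distrib nat_power_eq flip: mult_2)
  finally show ?thesis .
qed

text \<open>Round each coordinate down to a multiple of 1/N^2. The numerators stay in range because
  N * N^2 = N^3 is an integer, and the d coordinate errors add up through the l1 norm.\<close>

lemma grid_approx:
  fixes l :: "real ^ 'd"
  assumes "N > 0" "norm l \<le> real N"
  obtains g where "g \<in> grid N" "norm (l - g) \<le> CARD('d) / real N ^ 2"
proof -
  define z where "z = (\<lambda>i. \<lfloor>l $ i * real N ^ 2\<rfloor>)"
  define g :: "real ^ 'd" where "g = (\<chi> i. of_int (z i) / real N ^ 2)"
  have "z i \<in> {- (int N ^ 3)..int N ^ 3}" for i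
  proof -
    have "\<bar>l $ i\<bar> \<le> real N"
      using component_le_norm_cart[of l i] assms by linarith
    hence "\<bar>l $ i * real N ^ 2\<bar> \<le> real N * real N ^ 2"
      unfolding abs_mult by (intro mult_mono) auto
    hence "\<bar>l $ i * real N ^ 2\<bar> \<le> of_int (int N ^ 3)"
      by (simp add: power3_eq_cube power2_eq_square)
    thus ?thesis
      unfolding z_def abs_le_iff by (auto simp: le_floor_iff floor_le_iff)
  qed
  hence "g \<in> grid N"
    unfolding g_def grid_def by (intro imageI) auto
  moreover have "norm (l - g) \<le> CARD('d) / real N ^ 2"
  proof -
    have "\<bar>(l - g) $ i\<bar> \<le> 1 / real N ^ 2" for i
    proof -
      have "(l - g) $ i = (l $ i * real N ^ 2 - z i) / real N ^ 2"
        using assms by (simp add: g_def diff_divide_distrib)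
      moreover have "0 \<le> l $ i * real N ^ 2 - z i" "l $ i * real N ^ 2 - z i \<le> 1"
        unfolding z_def by linarith+
      ultimately show ?thesis
        by (simp add: divide_right_mono)
    qed
    hence "norm (l - g) \<le> (\<Sum>i\<in>(UNIV :: 'd set). 1 / real N ^ 2)"
      by (intro order.trans[OF norm_le_l1_cart] sum_mono)
    thus ?thesis
      by simp
  qed
  ultimately show ?thesis
    by (rule that)
qed

lemma norm_cnj_unit_exp_inner_diff_le:
  "norm (cnj (unit_exp (x \<bullet> l)) - cnj (unit_exp (x \<bullet> g))) \<le> 2 * pi * norm (l - g) * norm x"
proof -
  have "norm (cnj (unit_exp (x \<bullet> l)) - cnj (unit_exp (x \<bullet> g))) = norm (unit_exp (x \<bullet> l) - unit_exp (x \<bullet> g))"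
    by (metis complex_cnj_diff complex_mod_cnj)
  also have "\<dots> \<le> 2 * pi * \<bar>x \<bullet> (l - g)\<bar>"
    using norm_unit_exp_diff_le[of "x \<bullet> l" "x \<bullet> g"] by (simp add: inner_diff_right)
  also have "\<dots> \<le> 2 * pi * (norm x * norm (l - g))"
    by (intro mult_left_mono Cauchy_Schwarz_ineq2) auto
  finally show ?thesis
    by (simp add: mult_ac)
qed

text \<open>Identical distribution is encoded by one law \<open>\<mu>\<close> shared by all
  \<open>\<xi> n\<close>; the index 0 later shows that \<open>\<mu>\<close> is a probability measure
  on the Borel sets.\<close>

locale iid_perturbed_lattice = unit_density_lattice L + prob_space M
  for L :: "(real ^ 'd) set" and M :: "'w measure" +
  fixes \<xi> :: "real ^ 'd \<Rightarrow> 'w \<Rightarrow> real ^ 'd" and \<mu> :: "(real ^ 'd) measure" and \<epsilon> :: real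
  assumes indep: "indep_vars (\<lambda>_. borel) \<xi> L"
    and distr: "n \<in> L \<Longrightarrow> distr M borel (\<xi> n) = \<mu>"
    and \<epsilon>_pos: "\<epsilon> > 0"
    and moment: "integrable \<mu> (\<lambda>x. norm x powr (real CARD('d) + \<epsilon>))"
begin

section \<open>Moments of the common law and size of the perturbations\<close>

lemma \<xi>_measurable [measurable]: "n \<in> L \<Longrightarrow> \<xi> n \<in> borel_measurable M"
  using indep unfolding indep_vars_def by auto

lemma sets_\<mu> [measurable_cong, simp]: "sets \<mu> = sets borel"
  using distr[OF zero_mem] by auto

lemma prob_space_\<mu>: "prob_space \<mu>"
  using prob_space_distr[OF \<xi>_measurable[OF zero_mem]] distr[OF zero_mem] by simp

text \<open>Domination by 1 inside the unit ball and by the assumed moment outside it. The case k =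
  d bounds the number of large perturbations; k = 1 makes \<open>char_fun\<close> Lipschitz.\<close>

lemma integrable_norm_power:
  assumes "k \<le> CARD('d)"
  shows "integrable \<mu> (\<lambda>x. norm x ^ k)"
proof -
  interpret \<mu>: prob_space \<mu>
    by (rule prob_space_\<mu>)
  show ?thesis
  proof (rule Bochner_Integration.integrable_bound)
    show "integrable \<mu> (\<lambda>x. 1 + norm x powr (real CARD('d) + \<epsilon>))"
      by (intro Bochner_Integration.integrable_add moment) simp
    show "AE x in \<mu>. norm (norm x ^ k) \<le> norm (1 + norm x powr (real CARD('d) + \<epsilon>))"
    proof (intro AE_I2)
      fix x :: "real ^ 'd"
      show "norm (norm x ^ k) \<le> norm (1 + norm x powr (real CARD('d) + \<epsilon>))"
      proof (cases "norm x \<le> 1")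
        case True
        thus ?thesis
          using power_le_one[of "norm x" k] by (simp add: add_increasing2)
      next
        case False
        hence "norm x ^ k = norm x powr real k"
          by (subst powr_realpow) auto
        also have "\<dots> \<le> norm x powr (real CARD('d) + \<epsilon>)"
          using False assms \<epsilon>_pos by (intro powr_mono) auto
        finally show ?thesis
          by simp
      qed
    qed
  qed measurable
qed

lemma integrable_norm: "integrable \<mu> norm"
  using integrable_norm_power[of 1] by (simp add: Suc_le_eq)

text \<open>By Tonelli, the expected number of exceptional points equals
  \<open>\<integral> card {n \<in> L. \<delta> |n| < |x|} d\<mu>(x)\<close>, whose integrand grows like \<open>|x|\<close> to the power \<open>d\<close>.\<close>

lemma AE_finite_large_perturbations:
  assumes "\<delta> > 0"
  shows "AE \<omega> in M. finite {n \<in> L. \<delta> * norm n < norm (\<xi> n \<omega>)}"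
proof -
  define E where "E = (\<lambda>n :: real ^ 'd. {x :: real ^ 'd. \<delta> * norm n < norm x})"
  have [measurable]: "E n \<in> sets borel" for n
    unfolding E_def by measurable
  have count: "(\<integral>\<^sup>+n. indicator (E n) (y n) \<partial>count_space L) =
      emeasure (count_space L) {n \<in> L. \<delta> * norm n < norm (y n)}" for y :: "real ^ 'd \<Rightarrow> real ^ 'd"
  proof -
    have "(\<integral>\<^sup>+n. indicator (E n) (y n) \<partial>count_space L) =
        (\<integral>\<^sup>+n. indicator {n \<in> L. \<delta> * norm n < norm (y n)} n \<partial>count_space L)"
      by (intro nn_integral_cong) (simp add: E_def indicator_def)
    thus ?thesis
      by (simp add: nn_integral_indicator)
  qed
  obtain C :: real where C: "C \<ge> 0" "\<And>R. R \<ge> 0 \<Longrightarrow> card (L \<inter> cball 0 R) \<le> C * (1 + R ^ CARD('d))"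
    using count_bound by blast
  have "(\<integral>\<^sup>+\<omega>. \<integral>\<^sup>+n. indicator (E n) (\<xi> n \<omega>) \<partial>count_space L \<partial>M) =
      (\<integral>\<^sup>+n. \<integral>\<^sup>+\<omega>. indicator (E n) (\<xi> n \<omega>) \<partial>M \<partial>count_space L)"
    by (intro nn_integral_count_space_nn_integral countable) measurable
  also have "\<dots> = (\<integral>\<^sup>+n. \<integral>\<^sup>+x. indicator (E n) x \<partial>\<mu> \<partial>count_space L)"
  proof (intro nn_integral_cong)
    fix n assume "n \<in> space (count_space L)"
    hence n: "n \<in> L"
      by simp
    show "(\<integral>\<^sup>+\<omega>. indicator (E n) (\<xi> n \<omega>) \<partial>M) = (\<integral>\<^sup>+x. indicator (E n) x \<partial>\<mu>)"
      unfolding distr[OF n, symmetric] using n by (subst nn_integral_distr) auto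
  qed
  also have "\<dots> = (\<integral>\<^sup>+x. \<integral>\<^sup>+n. indicator (E n) x \<partial>count_space L \<partial>\<mu>)"
    by (intro nn_integral_count_space_nn_integral[symmetric] countable) measurable
  \<comment> \<open>For fixed \<open>x\<close> the indices counted satisfy |n| < |x|/\<delta>, so
    \<open>count_bound\<close> applies.\<close>
  also have "\<dots> \<le> (\<integral>\<^sup>+x. ennreal (C * (1 + (norm x / \<delta>) ^ CARD('d))) \<partial>\<mu>)"
  proof (intro nn_integral_mono)
    fix x :: "real ^ 'd"
    have "(\<integral>\<^sup>+n. indicator (E n) x \<partial>count_space L) = emeasure (count_space L) {n \<in> L. \<delta> * norm n < norm x}"
      by (rule count)
    also have "\<dots> \<le> emeasure (count_space L) (L \<inter> cball 0 (norm x / \<delta>))"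
      using assms by (intro emeasure_mono) (auto simp: field_simps)
    also have "\<dots> = ennreal (card (L \<inter> cball 0 (norm x / \<delta>)))"
      by (simp add: emeasure_count_space_finite finite_ball ennreal_of_nat_eq_real_of_nat)
    also have "\<dots> \<le> ennreal (C * (1 + (norm x / \<delta>) ^ CARD('d)))"
      using assms by (intro ennreal_leI C) auto
    finally show "(\<integral>\<^sup>+n. indicator (E n) x \<partial>count_space L) \<le> ennreal (C * (1 + (norm x / \<delta>) ^ CARD('d)))" .
  qed
  also have "\<dots> < \<infinity>"
  proof -
    interpret \<mu>: prob_space \<mu>
      by (rule prob_space_\<mu>)
    have "integrable \<mu> (\<lambda>x. C * (1 + (norm x / \<delta>) ^ CARD('d)))"
      unfolding power_divide
      by (intro integrable_mult_right Bochner_Integration.integrable_add integrable_divide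
          integrable_norm_power) auto
    from integrableD(2)[OF this] show ?thesis
      using C(1) assms by (simp add: top.not_eq_extremum)
  qed
  finally have "(\<integral>\<^sup>+\<omega>. \<integral>\<^sup>+n. indicator (E n) (\<xi> n \<omega>) \<partial>count_space L \<partial>M) \<noteq> \<infinity>"
    by simp
  \<comment> \<open>Measurability of the number of exceptional indices, needed to pass from a finite
    expectation to almost sure finiteness. Joint measurability follows from countability of
    \<open>L\<close>.\<close>
  moreover have "(\<lambda>\<omega>. \<integral>\<^sup>+n. indicator (E n) (\<xi> n \<omega>) \<partial>count_space L) \<in> borel_measurable M"
  proof -
    interpret count: sigma_finite_measure "count_space L"
      by (intro sigma_finite_measure_count_space_countable countable)
    have "(\<lambda>(n, \<omega>). indicator (E n) (\<xi> n \<omega>) :: ennreal) \<in> borel_measurable (count_space L \<Otimes>\<^sub>M M)"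
      by (intro measurable_pair_measure_countable1 countable) (simp, measurable)
    from measurable_compose[OF measurable_pair_swap' this] show ?thesis
      by (intro count.borel_measurable_nn_integral) (simp add: case_prod_beta')
  qed
  ultimately have "AE \<omega> in M. (\<integral>\<^sup>+n. indicator (E n) (\<xi> n \<omega>) \<partial>count_space L) \<noteq> \<infinity>"
    by (intro nn_integral_PInf_AE)
  thus ?thesis
  proof eventually_elim
    case (elim \<omega>)
    thus ?case
      unfolding count by (rule contrapos_np) (simp add: emeasure_count_space_infinite)
  qed
qed

text \<open>The exceptional set shrinks as \<delta> grows, so the countably many values 1/(k + 1)
  yield one null event for all \<delta>.\<close>

lemma AE_perturbation_little_o:
  "AE \<omega> in M. \<forall>\<delta>>0. finite {n \<in> L. \<delta> * norm n < norm (\<xi> n \<omega>)}"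
proof -
  have "AE \<omega> in M. \<forall>k. finite {n \<in> L. 1 / real (Suc k) * norm n < norm (\<xi> n \<omega>)}"
    by (intro AE_all_countable[THEN iffD2] allI AE_finite_large_perturbations) simp
  thus ?thesis
  proof eventually_elim
    case (elim \<omega>)
    show ?case
    proof (intro allI impI)
      fix \<delta> :: real assume "\<delta> > 0"
      then obtain k where k: "1 / real (Suc k) < \<delta>"
        using reals_Archimedean[of \<delta>] by (auto simp: inverse_eq_divide)
      have "{n \<in> L. \<delta> * norm n < norm (\<xi> n \<omega>)} \<subseteq> {n \<in> L. 1 / real (Suc k) * norm n < norm (\<xi> n \<omega>)}"
        using mult_right_mono[OF less_imp_le[OF k] norm_ge_zero] by (auto intro: order.strict_trans1)
      thus "finite {n \<in> L. \<delta> * norm n < norm (\<xi> n \<omega>)}"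
        by (rule finite_subset) (rule elim[THEN spec])
    qed
  qed
qed

section \<open>Uniform control of the centred exponential sums\<close>

definition summand :: "real ^ 'd \<Rightarrow> real ^ 'd \<Rightarrow> 'w \<Rightarrow> complex" where
  "summand l n \<omega> = cnj (unit_exp ((n + \<xi> n \<omega>) \<bullet> l))"

text \<open>The subtracted terms are the expectations of the summands
  (\<open>expectation_summand\<close>). The index set is the deterministic ball of lattice points,
  so the sum has a fixed number of independent terms.\<close>

definition deviation :: "real \<Rightarrow> real ^ 'd \<Rightarrow> 'w \<Rightarrow> complex" where
  "deviation R l \<omega> = (\<Sum>n\<in>L \<inter> cball 0 R. summand l n \<omega> - cnj (unit_exp (n \<bullet> l)) * char_fun \<mu> l)"

lemma borel_measurable_cnj_unit_exp_inner [measurable]: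
  "(\<lambda>x :: real ^ 'd. cnj (unit_exp (x \<bullet> l))) \<in> borel_measurable borel"
  unfolding unit_exp_def by (intro borel_measurable_continuous_onI continuous_intros)

lemma summand_measurable [measurable]: "n \<in> L \<Longrightarrow> summand l n \<in> borel_measurable M"
  unfolding summand_def[abs_def]
  by (rule measurable_compose[OF _ borel_measurable_cnj_unit_exp_inner]) measurable

lemma integrable_cnj_unit_exp_inner: "integrable \<mu> (\<lambda>x. cnj (unit_exp (x \<bullet> l)))"
proof -
  interpret \<mu>: prob_space \<mu>
    by (rule prob_space_\<mu>)
  show ?thesis
    by (rule \<mu>.integrable_const_bound[of _ 1]) (simp, measurable)
qed

lemma expectation_summand:
  assumes "n \<in> L"
  shows "expectation (summand l n) = cnj (unit_exp (n \<bullet> l)) * char_fun \<mu> l"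
proof -
  have "expectation (summand l n) = expectation (\<lambda>\<omega>. cnj (unit_exp (n \<bullet> l)) * cnj (unit_exp (\<xi> n \<omega> \<bullet> l)))"
    by (simp add: summand_def[abs_def] inner_add_left unit_exp_add)
  also have "\<dots> = cnj (unit_exp (n \<bullet> l)) * expectation (\<lambda>\<omega>. cnj (unit_exp (\<xi> n \<omega> \<bullet> l)))"
    by (rule integral_mult_right_zero)
  also have "expectation (\<lambda>\<omega>. cnj (unit_exp (\<xi> n \<omega> \<bullet> l))) = char_fun \<mu> l"
    unfolding char_fun_def distr[OF assms, symmetric] using assms
    by (subst integral_distr) auto
  finally show ?thesis .
qed

lemma prob_large_deviation:
  fixes \<delta> :: real
  assumes "\<delta> \<ge> 0" "R \<ge> 0"
  shows "prob {\<omega> \<in> space M. norm (deviation R l \<omega>) \<ge> 2 * \<delta> * card (L \<inter> cball 0 R)}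
    \<le> 4 * exp (- (\<delta>\<^sup>2 * card (L \<inter> cball 0 R) / 2))"
proof -
  have "indep_vars (\<lambda>_. borel) (\<lambda>n \<omega>. cnj (unit_exp ((n + \<xi> n \<omega>) \<bullet> l))) (L \<inter> cball 0 R)"
    by (rule indep_vars_compose2[OF indep_vars_subset[OF indep]]) auto
  moreover have "deviation R l \<omega> =
      (\<Sum>n\<in>L \<inter> cball 0 R. summand l n \<omega>) - (\<Sum>n\<in>L \<inter> cball 0 R. expectation (summand l n))" for \<omega>
    by (simp add: deviation_def sum_subtractf expectation_summand)
  \<comment> \<open>Hoeffding needs a nonempty index set; it contains 0 because R \<ge> 0.\<close>
  ultimately show ?thesis
    using assms zero_mem
    by (simp only:) (intro complex_Hoeffding finite_ball, auto simp: summand_def[abs_def])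
qed

text \<open>A linear lower bound, weaker than the true order N^d, already makes the Hoeffding bound
  exponentially small in \<open>N\<close>. The constant is half the unit ball volume because the
  count eventually exceeds half of \<open>vol\<close>.\<close>

lemma count_ge_linear:
  obtains c :: real where "c > 0" "\<forall>\<^sub>F N in sequentially. c * real N \<le> card (L \<inter> cball 0 (real N))"
proof -
  define c where "c = unit_ball_vol (CARD('d)) / 2"
  have "\<forall>\<^sub>F R in at_top. card (L \<inter> cball 0 R) / vol R > 1 / 2"
    using density unfolding vol_def by (rule order_tendstoD(1)) simp
  hence "\<forall>\<^sub>F N in sequentially. card (L \<inter> cball 0 (real N)) / vol (real N) > 1 / 2"
    by (rule eventually_compose_filterlim[OF _ filterlim_real_sequentially])
  hence "\<forall>\<^sub>F N in sequentially. c * real N \<le> card (L \<inter> cball 0 (real N))"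
    using eventually_gt_at_top[of 0]
  proof eventually_elim
    case (elim N)
    have "real N ^ 1 \<le> real N ^ CARD('d)"
      using elim by (intro power_increasing) (auto simp: Suc_le_eq)
    hence "c * real N \<le> c * real N ^ CARD('d)"
      by (intro mult_left_mono) (auto simp: c_def)
    also have "\<dots> = vol (real N) / 2"
      by (simp add: vol_eq c_def)
    also have "\<dots> \<le> card (L \<inter> cball 0 (real N))"
      using elim vol_pos[of N] by (simp add: pos_less_divide_eq)
    finally show ?case .
  qed
  thus ?thesis
    by (intro that[of c]) (auto simp: c_def)
qed

text \<open>Union bound over the polynomially many grid points, then Borel-Cantelli over the integer
  radii.\<close>

lemma AE_deviation_on_grid:
  fixes \<delta> :: real
  assumes "\<delta> > 0"
  shows "AE \<omega> in M. \<forall>\<^sub>F N in sequentially. \<forall>g\<in>grid N.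
    norm (deviation (real N) g \<omega>) < 2 * \<delta> * card (L \<inter> cball 0 (real N))"
proof -
  define m where "m = (\<lambda>N. real (card (L \<inter> cball 0 (real N))))"
  define A where "A = (\<lambda>N g. {\<omega> \<in> space M. norm (deviation (real N) g \<omega>) \<ge> 2 * \<delta> * m N})"
  obtain c :: real where c: "c > 0" "\<forall>\<^sub>F N in sequentially. c * real N \<le> m N"
    unfolding m_def by (rule count_ge_linear)
  have A: "A N g \<in> events" for N g
    unfolding A_def deviation_def by measurable
  have prob: "prob (\<Union>g\<in>grid N. A N g) \<le> (2 * real N ^ 3 + 1) ^ CARD('d) * (4 * exp (- (\<delta>\<^sup>2 * m N / 2)))" for N
  proof -
    have "prob (\<Union>g\<in>grid N. A N g) \<le> (\<Sum>g\<in>grid N. prob (A N g))"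
      using A by (intro finite_measure_subadditive_finite finite_grid) auto
    also have "\<dots> \<le> (\<Sum>g\<in>(grid N :: (real ^ 'd) set). 4 * exp (- (\<delta>\<^sup>2 * m N / 2)))"
      unfolding A_def m_def using assms by (intro sum_mono prob_large_deviation) auto
    also have "\<dots> = real (card (grid N :: (real ^ 'd) set)) * (4 * exp (- (\<delta>\<^sup>2 * m N / 2)))"
      by simp
    also have "\<dots> \<le> real ((2 * N ^ 3 + 1) ^ CARD('d)) * (4 * exp (- (\<delta>\<^sup>2 * m N / 2)))"
      by (intro mult_right_mono of_nat_mono card_grid_le) auto
    finally show ?thesis
      by (simp add: add.commute)
  qed
  define a where "a = \<delta>\<^sup>2 * c / 2"
  have "a > 0"
    using c assms by (simp add: a_def)
  \<comment> \<open>Grid size times the Hoeffding bound, with the count replaced by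
    \<open>c * N\<close>; comparison with 1/N^2 gives summability.\<close>
  have decay: "(\<lambda>N. (2 * real N ^ 3 + 1) ^ CARD('d) * (4 * exp (- a * real N))) \<in> o(\<lambda>N. 1 / real N ^ 2)"
    using \<open>a > 0\<close> by real_asymp
  have "\<forall>\<^sub>F N in sequentially. norm (prob (\<Union>g\<in>grid N. A N g)) \<le> 1 / real N ^ 2"
    using landau_o.smallD[OF decay zero_less_one] c(2)
  proof eventually_elim
    case (elim N)
    have "a * real N \<le> \<delta>\<^sup>2 * m N / 2"
      using mult_left_mono[OF elim(2), of "\<delta>\<^sup>2 / 2"] by (simp add: a_def mult_ac)
    hence "prob (\<Union>g\<in>grid N. A N g) \<le> (2 * real N ^ 3 + 1) ^ CARD('d) * (4 * exp (- a * real N))"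
      by (intro order.trans[OF prob] mult_left_mono) auto
    thus ?case
      using elim(1) by simp
  qed
  hence "summable (\<lambda>N. prob (\<Union>g\<in>grid N. A N g))"
    by (rule summable_comparison_test_ev) (use inverse_power_summable[of 2, where 'a = real] in \<open>simp add: inverse_eq_divide\<close>)
  hence "AE \<omega> in M. \<forall>\<^sub>F N in sequentially. \<omega> \<in> space M - (\<Union>g\<in>grid N. A N g)"
    using A by (intro borel_cantelli_AE1 sets.finite_UN finite_grid) (auto simp: emeasure_eq_measure)
  thus ?thesis
  proof eventually_elim
    case (elim \<omega>)
    thus ?case
      by (rule eventually_mono) (auto simp: A_def m_def)
  qed
qed

lemma norm_char_fun_le: "norm (char_fun \<mu> l) \<le> 1"
proof -
  interpret \<mu>: prob_space \<mu>
    by (rule prob_space_\<mu>)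
  have "norm (char_fun \<mu> l) \<le> (LINT x|\<mu>. norm (cnj (unit_exp (x \<bullet> l))))"
    unfolding char_fun_def by (rule integral_norm_bound)
  thus ?thesis
    by (simp add: \<mu>.prob_space)
qed

lemma char_fun_diff_le:
  "norm (char_fun \<mu> l - char_fun \<mu> g) \<le> 2 * pi * norm (l - g) * (LINT x|\<mu>. norm x)"
proof -
  have "char_fun \<mu> l - char_fun \<mu> g = (LINT x|\<mu>. cnj (unit_exp (x \<bullet> l)) - cnj (unit_exp (x \<bullet> g)))"
    unfolding char_fun_def
    by (intro Bochner_Integration.integral_diff[symmetric] integrable_cnj_unit_exp_inner)
  also have "norm \<dots> \<le> (LINT x|\<mu>. norm (cnj (unit_exp (x \<bullet> l)) - cnj (unit_exp (x \<bullet> g))))"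
    by (rule integral_norm_bound)
  also have "\<dots> \<le> (LINT x|\<mu>. 2 * pi * norm (l - g) * norm x)"
  proof (intro integral_mono)
    show "norm (cnj (unit_exp (x \<bullet> l)) - cnj (unit_exp (x \<bullet> g))) \<le> 2 * pi * norm (l - g) * norm x" for x
      by (rule norm_cnj_unit_exp_inner_diff_le)
  qed (intro integrable_norm integrable_mult_right integrable_cnj_unit_exp_inner
      Bochner_Integration.integrable_diff Bochner_Integration.integrable_norm)+
  finally show ?thesis
    by simp
qed

text \<open>Each centred term is Lipschitz in the frequency. Up to the factor 2 pi, its random part
  contributes |n + \<xi> n| \<le> 2R + K, and its mean contributes R from the lattice phase and the
  first moment from \<open>char_fun\<close>.\<close>

lemma deviation_diff_le:
  assumes K: "\<And>n. n \<in> L \<Longrightarrow> norm (\<xi> n \<omega>) \<le> norm n + K"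
    and "R \<ge> 0"
  shows "norm (deviation R l \<omega> - deviation R g \<omega>) \<le>
    card (L \<inter> cball 0 R) * (2 * pi * norm (l - g) * (3 * R + K + (LINT x|\<mu>. norm x)))"
proof -
  let ?e = "\<lambda>l n. cnj (unit_exp (n \<bullet> l))"
  have "deviation R l \<omega> - deviation R g \<omega> = (\<Sum>n\<in>L \<inter> cball 0 R.
      (summand l n \<omega> - summand g n \<omega>) - (?e l n * char_fun \<mu> l - ?e g n * char_fun \<mu> g))"
    unfolding deviation_def by (subst sum_subtractf[symmetric]) (intro sum.cong refl, simp)
  also have "norm \<dots> \<le> (\<Sum>n\<in>L \<inter> cball 0 R. 2 * pi * norm (l - g) * (3 * R + K + (LINT x|\<mu>. norm x)))"
  proof (intro sum_norm_le)
    fix n assume n: "n \<in> L \<inter> cball 0 R"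
    hence nR: "norm n \<le> R"
      by simp
    have "norm (n + \<xi> n \<omega>) \<le> 2 * R + K"
      using norm_triangle_ineq[of n "\<xi> n \<omega>"] K[of n] n by auto
    hence 1: "norm (summand l n \<omega> - summand g n \<omega>) \<le> 2 * pi * norm (l - g) * (2 * R + K)"
      unfolding summand_def
      by (intro order.trans[OF norm_cnj_unit_exp_inner_diff_le] mult_left_mono) auto
    \<comment> \<open>Product splitting in which the factors left undifferenced have norm at most
      1.\<close>
    have "?e l n * char_fun \<mu> l - ?e g n * char_fun \<mu> g =
        ?e l n * (char_fun \<mu> l - char_fun \<mu> g) + (?e l n - ?e g n) * char_fun \<mu> g"
      by (simp add: algebra_simps)
    also have "norm \<dots> \<le> norm (char_fun \<mu> l - char_fun \<mu> g) + norm (?e l n - ?e g n) * 1"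
      by (intro order.trans[OF norm_triangle_ineq] add_mono)
         (auto simp: norm_mult intro!: mult_left_le norm_char_fun_le)
    also have "\<dots> \<le> 2 * pi * norm (l - g) * (LINT x|\<mu>. norm x) + 2 * pi * norm (l - g) * R"
      unfolding mult_1_right using nR
      by (intro add_mono char_fun_diff_le order.trans[OF norm_cnj_unit_exp_inner_diff_le] mult_left_mono) auto
    finally have 2: "norm (?e l n * char_fun \<mu> l - ?e g n * char_fun \<mu> g) \<le>
      2 * pi * norm (l - g) * (LINT x|\<mu>. norm x) + 2 * pi * norm (l - g) * R" .
    show "norm ((summand l n \<omega> - summand g n \<omega>) - (?e l n * char_fun \<mu> l - ?e g n * char_fun \<mu> g))
        \<le> 2 * pi * norm (l - g) * (3 * R + K + (LINT x|\<mu>. norm x))"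
      using norm_triangle_ineq4 1 2 by (rule order.trans[OF _ order.trans[OF add_mono]]) (simp add: algebra_simps)
  qed
  finally show ?thesis
    by simp
qed

text \<open>For fixed \<omega> in one good event, any frequency is compared at radius
  \<open>N\<close> with a nearby grid point: the grid estimate and the Lipschitz error each cost at
  most \<eta>/2 per lattice point. The good event is chosen before the frequency.\<close>

lemma AE_deviation_tendsto:
  "AE \<omega> in M. \<forall>l. (\<lambda>N. deviation (real N) l \<omega> / of_real (vol (real N))) \<longlonglongrightarrow> 0"
proof -
  define m where "m = (\<lambda>N. real (card (L \<inter> cball 0 (real N))))"
  have m_pos: "m N > 0" for N
    using zero_mem finite_ball[of "real N"] unfolding m_def by (auto simp: card_gt_0_iff)
  have "AE \<omega> in M. \<forall>k. \<forall>\<^sub>F N in sequentially. \<forall>g\<in>grid N.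
      norm (deviation (real N) g \<omega>) < 2 * (1 / real (Suc k)) * m N"
    unfolding m_def by (intro AE_all_countable[THEN iffD2] allI AE_deviation_on_grid) simp
  thus ?thesis
    using AE_perturbation_little_o
  proof eventually_elim
    case (elim \<omega>)
    \<comment> \<open>With \<delta> = 1 all but finitely many perturbations are bounded by |n|;
      adding the total size \<open>K\<close> of the exceptions gives a bound for every
      \<open>n\<close>.\<close>
    define F where "F = {n \<in> L. 1 * norm n < norm (\<xi> n \<omega>)}"
    define K where "K = (\<Sum>n\<in>F. norm (\<xi> n \<omega>))"
    have "finite F"
      unfolding F_def using elim(2) zero_less_one by blast
    have K: "norm (\<xi> n \<omega>) \<le> norm n + K" if "n \<in> L" for n
    proof (cases "n \<in> F")
      case True
      hence "norm (\<xi> n \<omega>) \<le> K"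
        unfolding K_def using \<open>finite F\<close> by (intro member_le_sum) auto
      thus ?thesis
        using norm_ge_zero[of n] by linarith
    next
      case False
      moreover have "K \<ge> 0"
        by (auto simp: K_def intro: sum_nonneg)
      ultimately show ?thesis
        using that by (simp add: F_def)
    qed
    define c where "c = K + (LINT x|\<mu>. norm x)"
    \<comment> \<open>The Lipschitz bound of \<open>deviation_diff_le\<close> at distance d/N^2; it
      is of order 1/N.\<close>
    define err where "err = (\<lambda>N. 2 * pi * (CARD('d) / real N ^ 2) * (3 * real N + c))"
    have err: "err \<longlonglongrightarrow> 0"
      unfolding err_def by real_asymp
    have "c \<ge> 0"
      unfolding c_def K_def by (intro add_nonneg_nonneg sum_nonneg Bochner_Integration.integral_nonneg) auto
    show ?case
    proof
      fix l :: "real ^ 'd"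
      have "(\<lambda>N. deviation (real N) l \<omega> / of_real (m N)) \<longlonglongrightarrow> 0"
      proof (rule tendstoI)
        fix \<eta> :: real assume "\<eta> > 0"
        then obtain k where k: "1 / real (Suc k) < \<eta> / 4"
          using reals_Archimedean[of "\<eta> / 4"] by (auto simp: inverse_eq_divide)
        have "\<forall>\<^sub>F N in sequentially. norm l \<le> real N"
          using filterlim_real_sequentially by (simp add: filterlim_at_top)
        moreover have "\<forall>\<^sub>F N in sequentially. err N < \<eta> / 2"
          using err \<open>\<eta> > 0\<close> by (intro order_tendstoD(2)) auto
        moreover note spec[OF elim(1), of k] eventually_gt_at_top[of 0]
        ultimately show "\<forall>\<^sub>F N in sequentially. dist (deviation (real N) l \<omega> / of_real (m N)) 0 < \<eta>"
        proof eventually_elim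
          case (elim N)
          obtain g where g: "g \<in> grid N" "norm (l - g) \<le> CARD('d) / real N ^ 2"
            using grid_approx[OF elim(4,1)] .
          have "norm (deviation (real N) l \<omega>) \<le>
              norm (deviation (real N) g \<omega>) + norm (deviation (real N) l \<omega> - deviation (real N) g \<omega>)"
            by (rule norm_triangle_sub)
          also have "norm (deviation (real N) l \<omega> - deviation (real N) g \<omega>)
              \<le> m N * (2 * pi * norm (l - g) * (3 * real N + c))"
            using deviation_diff_le[OF K, of "real N" l g] by (simp add: m_def c_def add.assoc)
          also have "\<dots> \<le> m N * err N"
            unfolding err_def using m_pos[of N] g(2) \<open>c \<ge> 0\<close>
            by (intro mult_left_mono mult_right_mono) auto
          also have "\<dots> \<le> m N * (\<eta> / 2)"
            using elim(2) m_pos[of N] by (intro mult_left_mono) auto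
          also have "norm (deviation (real N) g \<omega>) < 2 * (1 / real (Suc k)) * m N"
            using elim(3) g(1) by blast
          also have "2 * (1 / real (Suc k)) * m N \<le> \<eta> / 2 * m N"
            using k m_pos[of N] by (intro mult_right_mono) auto
          finally have "norm (deviation (real N) l \<omega>) < \<eta> * m N"
            by (simp add: algebra_simps)
          thus ?case
            using m_pos[of N] by (simp add: norm_divide pos_divide_less_eq)
        qed
      qed
      \<comment> \<open>Density one converts normalisation by the count into normalisation by
        volume.\<close>
      moreover have "(\<lambda>N. complex_of_real (m N / vol (real N))) \<longlonglongrightarrow> of_real 1"
        using filterlim_compose[OF density filterlim_real_sequentially]
        unfolding m_def vol_def by (rule tendsto_of_real)
      ultimately have "(\<lambda>N. deviation (real N) l \<omega> / of_real (m N) * complex_of_real (m N / vol (real N))) \<longlonglongrightarrow> 0 * of_real 1"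
        by (rule tendsto_mult)
      thus "(\<lambda>N. deviation (real N) l \<omega> / of_real (vol (real N))) \<longlonglongrightarrow> 0"
        using m_pos by (simp add: less_imp_neq[symmetric])
    qed
  qed
qed

section \<open>Comparison of index sets and passage to all radii\<close>

lemma symdiff_subset_annulus:
  assumes \<delta>: "0 < \<delta>" "\<delta> < 1" and R: "R > 1 / \<delta>"
    and n: "n \<in> L" "norm (\<xi> n \<omega>) \<le> \<delta> / 4 * norm n"
    and diff: "(n + \<xi> n \<omega> \<in> cball 0 R) \<noteq> (n \<in> cball 0 (real (nat \<lfloor>R\<rfloor>)))"
  shows "n \<in> annulus \<delta> R"
proof -
  have "R > 0"
    using R \<delta> by (meson divide_pos_pos less_trans zero_less_one)
  have "R * \<delta> > 1"
    using R \<delta> by (simp add: pos_divide_less_eq)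
  have floor: "real (nat \<lfloor>R\<rfloor>) \<le> R" "real (nat \<lfloor>R\<rfloor>) > R - 1"
    using \<open>R > 0\<close> by linarith+
  have up: "norm (n + \<xi> n \<omega>) \<le> (1 + \<delta> / 4) * norm n"
    using norm_triangle_ineq[of n "\<xi> n \<omega>"] n(2) by (simp add: algebra_simps)
  have low: "norm (n + \<xi> n \<omega>) \<ge> (1 - \<delta> / 4) * norm n"
    using norm_diff_ineq[of n "\<xi> n \<omega>"] n(2) by (simp add: algebra_simps)
  show ?thesis
  proof (cases "n \<in> cball 0 (real (nat \<lfloor>R\<rfloor>))")
    case True
    hence "norm n \<le> R"
      using floor by simp
    moreover have "R < (1 + \<delta> / 4) * norm n"
      using True diff up by simp
    \<comment> \<open>Combined with R < (1 + \<delta>/4)|n| this yields the inner bound of the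
      annulus.\<close>
    moreover have "(1 - \<delta>) * ((1 + \<delta> / 4) * norm n) \<le> 1 * norm n"
      unfolding mult.assoc[symmetric] using \<delta> by (intro mult_right_mono) (auto simp: algebra_simps)
    ultimately have "(1 - \<delta>) * R < norm n"
      using \<delta> mult_strict_left_mono[of R "(1 + \<delta> / 4) * norm n" "1 - \<delta>"] by linarith
    moreover have "R \<le> (1 + \<delta>) * R"
      using \<open>R > 0\<close> \<delta> by simp
    ultimately show ?thesis
      using \<open>norm n \<le> R\<close> n(1) by (simp add: annulus_def)
  next
    case False
    \<comment> \<open>Rounding down loses less than 1, and 1 < \<delta>R.\<close>
    hence "norm n > (1 - \<delta>) * R"
      using floor \<open>R * \<delta> > 1\<close> by (simp add: algebra_simps)
    moreover have "norm n \<le> (1 + \<delta>) * R"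
    proof -
      have "\<delta> * \<delta> \<le> \<delta> * 1"
        using \<delta> by (intro mult_left_mono) auto
      \<comment> \<open>The inequality (1 + \<delta>)(1 - \<delta>/4) \<ge> 1 follows from
        \<delta>^2 \<le> \<delta>.\<close>
      hence "1 * norm n \<le> (1 + \<delta>) * (1 - \<delta> / 4) * norm n"
        using \<delta> by (intro mult_right_mono) (auto simp: algebra_simps)
      also have "\<dots> \<le> (1 + \<delta>) * R"
        unfolding mult.assoc using \<delta> False diff low by (intro mult_left_mono) auto
      finally show ?thesis
        by simp
    qed
    ultimately show ?thesis
      using n(1) by (simp add: annulus_def)
  qed
qed

text \<open>The deviation is controlled only along integer radii, so the points in the ball of
  radius \<open>R\<close> are compared with lattice points of norm at most the floor of
  \<open>R\<close>. The sum over the latter is a negligible deviation plus \<open>char_fun\<close>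
  times the lattice sum.\<close>

theorem AE_ball_average_tendsto:
  "AE \<omega> in M. \<forall>l. ((\<lambda>R. ball_average L (perturbed_lattice \<xi> \<omega>) R l) \<longlongrightarrow>
    (if l \<in> dual_lattice L then char_fun \<mu> l else 0)) at_top"
  using AE_deviation_tendsto AE_perturbation_little_o
proof eventually_elim
  case (elim \<omega>)
  show ?case
  proof
    fix l :: "real ^ 'd"
    define \<nu> where "\<nu> = (\<lambda>R. nat \<lfloor>R :: real\<rfloor>)"
    define A where "A = (\<lambda>R. {n \<in> L. n + \<xi> n \<omega> \<in> cball 0 R})"
    define S where "S = (\<lambda>R. \<Sum>n\<in>L \<inter> cball 0 R. summand l n \<omega>)"
    define lim where "lim = (if l \<in> dual_lattice L then char_fun \<mu> l else 0)"
    \<comment> \<open>Ensures that \<open>ball_average\<close> is a genuine sum and not the default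
      0. If |\<xi> n| \<le> |n|/2 and |n + \<xi> n| \<le> R, then |n| \<le> 2R.\<close>
    have finite_A: "finite (A R)" for R
    proof (rule finite_subset)
      show "A R \<subseteq> {n \<in> L. 1 / 2 * norm n < norm (\<xi> n \<omega>)} \<union> (L \<inter> cball 0 (2 * R))"
      proof
        fix n assume n: "n \<in> A R"
        have "norm n \<le> norm (n + \<xi> n \<omega>) + norm (\<xi> n \<omega>)"
          using norm_triangle_ineq4[of "n + \<xi> n \<omega>" "\<xi> n \<omega>"] by simp
        thus "n \<in> {n \<in> L. 1 / 2 * norm n < norm (\<xi> n \<omega>)} \<union> (L \<inter> cball 0 (2 * R))"
          using n by (auto simp: A_def)
      qed
      show "finite ({n \<in> L. 1 / 2 * norm n < norm (\<xi> n \<omega>)} \<union> (L \<inter> cball 0 (2 * R)))"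
        using elim(2)[rule_format, of "1 / 2"] finite_ball by simp
    qed
    have "((\<lambda>R. ((\<Sum>n\<in>A R. summand l n \<omega>) - (\<Sum>n\<in>L \<inter> cball 0 (real (\<nu> R)). summand l n \<omega>)) / of_real (vol R)) \<longlongrightarrow> 0) at_top"
    proof (rule sum_diff_tendsto_0)
      fix \<delta> :: real assume \<delta>: "0 < \<delta>" "\<delta> < 1"
      define F where "F = {n \<in> L. \<delta> / 4 * norm n < norm (\<xi> n \<omega>)}"
      have "finite F"
        unfolding F_def using elim(2)[rule_format, of "\<delta> / 4"] \<delta>(1) by linarith
      moreover have "\<forall>\<^sub>F R in at_top. (A R - L \<inter> cball 0 (real (\<nu> R))) \<union> (L \<inter> cball 0 (real (\<nu> R)) - A R) \<subseteq> F \<union> annulus \<delta> R"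
        using eventually_gt_at_top[of "1 / \<delta>"]
      proof eventually_elim
        case (elim R)
        show ?case
        proof
          fix n assume "n \<in> (A R - L \<inter> cball 0 (real (\<nu> R))) \<union> (L \<inter> cball 0 (real (\<nu> R)) - A R)"
          hence "n \<in> L" "(n + \<xi> n \<omega> \<in> cball 0 R) \<noteq> (n \<in> cball 0 (real (nat \<lfloor>R\<rfloor>)))"
            by (auto simp: A_def \<nu>_def)
          thus "n \<in> F \<union> annulus \<delta> R"
            using symdiff_subset_annulus[OF \<delta> elim, of n \<omega>] by (cases "n \<in> F") (auto simp: F_def)
        qed
      qed
      ultimately show "\<exists>F. finite F \<and> (\<forall>\<^sub>F R in at_top.
          (A R - L \<inter> cball 0 (real (\<nu> R))) \<union> (L \<inter> cball 0 (real (\<nu> R)) - A R) \<subseteq> F \<union> annulus \<delta> R)"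
        by blast
    qed (auto simp: finite_A finite_ball summand_def)
    hence diff: "((\<lambda>R. ((\<Sum>n\<in>A R. summand l n \<omega>) - S (real (\<nu> R))) / of_real (vol R)) \<longlongrightarrow> 0) at_top"
      by (simp add: S_def)
    have S_eq: "S R = deviation R l \<omega> + char_fun \<mu> l * (\<Sum>n\<in>L \<inter> cball 0 R. cnj (unit_exp (n \<bullet> l)))" for R
      by (simp add: S_def deviation_def sum_subtractf sum_distrib_left mult.commute)
    have "(\<lambda>N. deviation (real N) l \<omega> / of_real (vol (real N)) + char_fun \<mu> l *
        ((\<Sum>n\<in>L \<inter> cball 0 (real N). cnj (unit_exp (n \<bullet> l))) / of_real (vol (real N))))
      \<longlonglongrightarrow> 0 + char_fun \<mu> l * (if l \<in> dual_lattice L then 1 else 0)"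
      using elim(1) by (intro tendsto_add tendsto_mult tendsto_const
          filterlim_compose[OF exponential_sum_tendsto filterlim_real_sequentially]) blast
    hence S_lim: "(\<lambda>N. S (real N) / of_real (vol (real N))) \<longlonglongrightarrow> lim"
      by (cases "l \<in> dual_lattice L") (simp_all add: S_eq add_divide_distrib lim_def)
    have \<nu>_lim: "filterlim \<nu> at_top at_top"
      unfolding \<nu>_def by (intro filterlim_compose[OF filterlim_nat_sequentially] filterlim_floor_sequentially)
    \<comment> \<open>Replaces the volume at the rounded radius by that at \<open>R\<close>.\<close>
    have vol_ratio: "((\<lambda>R. vol (real (\<nu> R)) / vol R) \<longlongrightarrow> 1) at_top"
    proof (rule Lim_transform_eventually)
      have "((\<lambda>R :: real. of_int \<lfloor>R\<rfloor> / R) \<longlongrightarrow> 1) at_top"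
        by real_asymp
      from tendsto_power[OF this, of "CARD('d)"]
      show "((\<lambda>R :: real. (of_int \<lfloor>R\<rfloor> / R) ^ CARD('d)) \<longlongrightarrow> 1) at_top"
        by simp
      show "\<forall>\<^sub>F R in at_top. (of_int \<lfloor>R\<rfloor> / R) ^ CARD('d) = vol (real (\<nu> R)) / vol R"
        using eventually_gt_at_top[of 0]
      proof eventually_elim
        case (elim R)
        have "unit_ball_vol (CARD('d)) > 0"
          by simp
        thus ?case
          using elim by (simp add: vol_eq \<nu>_def power_divide less_imp_neq[symmetric])
      qed
    qed
    have "((\<lambda>R. S (real (\<nu> R)) / of_real (vol (real (\<nu> R))) * complex_of_real (vol (real (\<nu> R)) / vol R)) \<longlongrightarrow> lim * of_real 1) at_top"
      by (intro tendsto_mult tendsto_of_real vol_ratio filterlim_compose[OF S_lim \<nu>_lim])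
    moreover have "\<forall>\<^sub>F R in at_top. S (real (\<nu> R)) / of_real (vol (real (\<nu> R))) * complex_of_real (vol (real (\<nu> R)) / vol R)
        = S (real (\<nu> R)) / of_real (vol R)"
      \<comment> \<open>From R \<ge> 1 on the rounded radius is positive and its volume can be
        cancelled.\<close>
      using eventually_ge_at_top[of 1]
    proof eventually_elim
      case (elim R)
      hence "real (\<nu> R) > 0"
        by (simp add: \<nu>_def)
      thus ?case
        using vol_pos[of "real (\<nu> R)"] by simp
    qed
    ultimately have "((\<lambda>R. S (real (\<nu> R)) / of_real (vol R)) \<longlongrightarrow> lim * of_real 1) at_top"
      by (rule Lim_transform_eventually)
    from tendsto_add[OF diff this]
    show "((\<lambda>R. ball_average L (perturbed_lattice \<xi> \<omega>) R l) \<longlongrightarrow> lim) at_top"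
      by (simp add: ball_average_def perturbed_lattice_def A_def summand_def vol_def diff_divide_distrib
          del: measure_completion mem_cball_0)
  qed
qed

end

theorem theorem1:
  fixes L D :: "(real ^ 'd) set"
    and M :: "'w measure"
    and \<xi> :: "real ^ 'd \<Rightarrow> 'w \<Rightarrow> real ^ 'd"
    and \<mu> :: "(real ^ 'd) measure"
    and \<epsilon> :: real
  assumes "full_lattice L"
    and "fundamental_domain L D"
    and "emeasure lebesgue D = 1"
    and "prob_space M"
    and "prob_space.indep_vars M (\<lambda>_. borel) \<xi> L"
    and "\<And>n. n \<in> L \<Longrightarrow> distr M borel (\<xi> n) = \<mu>"
    and "\<epsilon> > 0"
    and "integrable \<mu> (\<lambda>x. norm x powr (real CARD('d) + \<epsilon>))"
  shows "AE \<omega> in M. \<forall>l :: real ^ 'd.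
           ((\<lambda>R. ball_average L (perturbed_lattice \<xi> \<omega>) R l) \<longlongrightarrow>
             (if l \<in> dual_lattice L then char_fun \<mu> l else 0)) at_top"
proof -
  interpret prob_space M
    by fact
  \<comment> \<open>The normalisation of \<open>D\<close> enters here, through the density of
    \<open>L\<close>.\<close>
  interpret iid_perturbed_lattice L M \<xi> \<mu> \<epsilon>
    by unfold_locales
      (fact full_lattice_zero[OF assms(1)] full_lattice_diff[OF assms(1)]
        full_lattice_density[OF assms(1-3)] assms)+
  show ?thesis
    by (rule AE_ball_average_tendsto)
qed

end
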